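(* Let $t \geq 2$ be an even integer and let $G$ be a $3$-connected $2t$-regular graph. Let $\mathcal{O}$ be a set of pairwise edge-disjoint cycles of $G$, each of length at least $3$. Then there exists a $t$-factor $F$ of $G$ such that for every $O \in \mathcal{O}$ both $E(O) \cap E(F) \neq \emptyset$ and $E(O) \cap (E(G) \setminus E(F)) \neq \emptyset$.
   Context: All graphs are finite and loopless but may have parallel edges. A cycle is a connected $2$-regular subgraph; its length is its number of edges. A $t$-factor of $G$ is a spanning $t$-regular subgraph. $3$-connected means $G$ has more than $3$ vertices and remains connected after deleting any at most $2$ vertices. *)

theory Defs
  imports Main
begin

definition multigraph :: "'v set \<Rightarrow> 'e set \<Rightarrow> ('e \<Rightarrow> 'v set) \<Rightarrow> bool" where
  "multigraph V E ends \<longleftrightarrow> finite V \<and> finite E \<and>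
     (\<forall>e\<in>E. ends e \<subseteq> V \<and> card (ends e) = 2)"

definition degree_in :: "'e set \<Rightarrow> ('e \<Rightarrow> 'v set) \<Rightarrow> 'v \<Rightarrow> nat" where
  "degree_in E ends v = card {e \<in> E. v \<in> ends e}"

definition adj :: "'v set \<Rightarrow> 'e set \<Rightarrow> ('e \<Rightarrow> 'v set) \<Rightarrow> 'v \<Rightarrow> 'v \<Rightarrow> bool" where
  "adj V E ends x y \<longleftrightarrow> x \<in> V \<and> y \<in> V \<and> (\<exists>e\<in>E. ends e = {x, y})"

definition connected_graph :: "'v set \<Rightarrow> 'e set \<Rightarrow> ('e \<Rightarrow> 'v set) \<Rightarrow> bool" where
  "connected_graph V E ends \<longleftrightarrow> V \<noteq> {} \<and>
     (\<forall>x\<in>V. \<forall>y\<in>V. (adj V E ends)\<^sup>*\<^sup>* x y)"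

definition three_connected :: "'v set \<Rightarrow> 'e set \<Rightarrow> ('e \<Rightarrow> 'v set) \<Rightarrow> bool" where
  "three_connected V E ends \<longleftrightarrow> card V > 3 \<and>
     (\<forall>S. S \<subseteq> V \<and> card S \<le> 2 \<longrightarrow>
        connected_graph (V - S) {e \<in> E. ends e \<inter> S = {}} ends)"

definition regular :: "'v set \<Rightarrow> 'e set \<Rightarrow> ('e \<Rightarrow> 'v set) \<Rightarrow> nat \<Rightarrow> bool" where
  "regular V E ends k \<longleftrightarrow> (\<forall>v\<in>V. degree_in E ends v = k)"

text \<open>A cycle, identified with its edge set C: a connected 2-regular subgraph
  (its vertex set is the set of ends of its edges). Its length is card C.\<close>
definition is_cycle :: "'e set \<Rightarrow> ('e \<Rightarrow> 'v set) \<Rightarrow> 'e set \<Rightarrow> bool" where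
  "is_cycle E ends C \<longleftrightarrow> C \<subseteq> E \<and> C \<noteq> {} \<and>
     regular (\<Union>(ends ` C)) C ends 2 \<and> connected_graph (\<Union>(ends ` C)) C ends"

definition is_factor :: "'v set \<Rightarrow> 'e set \<Rightarrow> ('e \<Rightarrow> 'v set) \<Rightarrow> nat \<Rightarrow> 'e set \<Rightarrow> bool" where
  "is_factor V E ends t F \<longleftrightarrow> F \<subseteq> E \<and> regular V F ends t"

end

theory Submission
  imports Defs "HOL-Library.Disjoint_Sets"
begin

text \<open>An even graph all of whose components have an even number of edges has a factor taking half of the
  edges at each vertex: alternate along Euler tours. To make such a factor split every given cycle \<open>C\<close>,
  detach \<open>C\<close> at one or more of its vertices, so that both of its edges there meet in a new vertex of
  degree 2; what has to be ensured is that all components keep an even number of edges.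

  Partition \<open>E\<close> into the given cycles and connected even pieces of the remaining graph. Take \<open>|C| - 2\<close>
  copies of each given cycle and \<open>|X|\<close> copies of every other part, and join two copies if their parts
  share a vertex. Since \<open>G\<close> has no cut vertex and \<open>t\<close> is even, an odd set of parts that is cut off by
  removing other parts meets these at least three times; as \<open>|C| / 3 \<le> |C| - 2\<close>, Tutte's condition
  holds and the copies have a perfect matching. Choose a common vertex for each matched pair, and let
  a part stay attached at a vertex iff this vertex was chosen for an odd number of its copies. A given
  cycle is then detached somewhere, because it has fewer copies than vertices.\<close>

subsection \<open>Matchings\<close>

definition matching_on :: "'a set \<Rightarrow> ('a \<Rightarrow> 'a \<Rightarrow> bool) \<Rightarrow> 'a set set \<Rightarrow> bool" where
  "matching_on A r M \<longleftrightarrow>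
     (\<forall>e\<in>M. \<exists>x\<in>A. \<exists>y\<in>A. x \<noteq> y \<and> r x y \<and> e = {x, y}) \<and> disjoint M"

definition maximum_matching :: "'a set \<Rightarrow> ('a \<Rightarrow> 'a \<Rightarrow> bool) \<Rightarrow> 'a set set \<Rightarrow> bool" where
  "maximum_matching A r M \<longleftrightarrow>
     matching_on A r M \<and> (\<forall>N. matching_on A r N \<longrightarrow> card N \<le> card M)"

lemma matching_on_subset: "matching_on A r M \<Longrightarrow> \<Union>M \<subseteq> A"
  by (auto simp: matching_on_def)

lemma matching_on_finite:
  assumes "finite A" "matching_on A r M"
  shows "finite M"
  using finite_subset[OF matching_on_subset[OF assms(2)] assms(1)] by (rule finite_UnionD)

lemma card_Union_matching:
  assumes "finite A" "matching_on A r M"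
  shows "card (\<Union>M) = 2 * card M"
proof -
  have two: "card e = 2" if "e \<in> M" for e
    using that assms(2) unfolding matching_on_def by fastforce
  have "card (\<Union>M) = sum card M"
    using assms(2) two unfolding matching_on_def
    by (intro card_Union_disjoint) (auto simp: disjoint_def pairwise_def disjnt_def card_ge_0_finite)
  then show ?thesis
    using two by simp
qed

lemma matching_on_insert:
  assumes "matching_on A r M" "x \<in> A" "y \<in> A" "x \<noteq> y" "r x y" "x \<notin> \<Union>M" "y \<notin> \<Union>M"
  shows "matching_on A r (insert {x, y} M)"
  unfolding matching_on_def
proof
  show "\<forall>e\<in>insert {x, y} M. \<exists>a\<in>A. \<exists>b\<in>A. a \<noteq> b \<and> r a b \<and> e = {a, b}"
    using assms(1-5) unfolding matching_on_def by blast
  have "disjoint M" using assms(1) unfolding matching_on_def by blast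
  then show "disjoint (insert {x, y} M)"
    using assms(6,7) by (auto simp: pairwise_insert disjnt_def)
qed

lemma matching_on_Diff: "matching_on A r M \<Longrightarrow> matching_on A r (M - N)"
  unfolding matching_on_def by (simp add: pairwise_def)

lemma matching_on_mono: "matching_on A r M \<Longrightarrow> A \<subseteq> B \<Longrightarrow> matching_on B r M"
  unfolding matching_on_def by (meson subsetD)

lemma matching_edge_other:
  assumes "symp r" "matching_on A r M" "e \<in> M" "x \<in> e"
  obtains y where "y \<in> A" "x \<noteq> y" "r x y" "e = {x, y}"
proof -
  obtain a b where "a \<in> A" "b \<in> A" "a \<noteq> b" "r a b" "e = {a, b}"
    using assms unfolding matching_on_def by blast
  with assms(1,4) that show thesis
    by (metis insertE insert_commute singletonD sympD)
qed

lemma maximum_matching_exists: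
  assumes "finite A"
  obtains M where "maximum_matching A r M"
proof -
  have "matching_on A r {}" by (simp add: matching_on_def)
  moreover have "\<forall>M. matching_on A r M \<longrightarrow> card M < Suc (card A)"
  proof (intro allI impI)
    fix M assume "matching_on A r M"
    then show "card M < Suc (card A)"
      using card_Union_matching[OF assms] card_mono[OF assms matching_on_subset] by fastforce
  qed
  ultimately obtain M where "matching_on A r M" "\<forall>N. matching_on A r N \<longrightarrow> card N \<le> card M"
    using ex_has_greatest_nat[of "matching_on A r" "{}" card "Suc (card A)"] by blast
  then show thesis
    using that unfolding maximum_matching_def by blast
qed

section \<open>Gallai's lemma and the Tutte-Berge formula\<close>

text \<open>Exchange argument: against a maximum matching \<open>M\<close> missing both
  \<open>u\<close> and \<open>v\<close>, take a maximum matching \<open>N\<close> that misses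
  \<open>w\<close> and shares as many edges with \<open>M\<close> as possible. Swapping one edge of
  \<open>N\<close> for an edge of \<open>M\<close> then gives a larger overlap.\<close>

lemma gallai_transitive:
  assumes fin: "finite A" and sym: "symp r"
    and w: "maximum_matching A r N0" "w \<notin> \<Union>N0"
    and uw: "\<And>M. maximum_matching A r M \<Longrightarrow> u \<in> \<Union>M \<or> w \<in> \<Union>M"
    and wv: "\<And>M. maximum_matching A r M \<Longrightarrow> w \<in> \<Union>M \<or> v \<in> \<Union>M"
    and "u \<noteq> v" and M: "maximum_matching A r M"
  shows "u \<in> \<Union>M \<or> v \<in> \<Union>M"
proof (rule ccontr)
  assume uvM: "\<not> ?thesis"
  then have wM: "w \<in> \<Union>M" using uw[OF M] by blast
  have mM: "matching_on A r M" using M by (simp add: maximum_matching_def)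
  have finM: "finite M" using matching_on_finite[OF fin mM] .
  let ?P = "\<lambda>N. maximum_matching A r N \<and> w \<notin> \<Union>N"
  have "\<forall>N. ?P N \<longrightarrow> card (M \<inter> N) < Suc (card M)"
    by (simp add: card_mono finM less_Suc_eq_le)
  then obtain N where N: "?P N" and Nmax: "\<And>N'. ?P N' \<Longrightarrow> card (M \<inter> N') \<le> card (M \<inter> N)"
    using ex_has_greatest_nat[of ?P N0 "\<lambda>N. card (M \<inter> N)" "Suc (card M)"] w by blast
  have mN: "matching_on A r N" using N by (simp add: maximum_matching_def)
  have finN: "finite N" using matching_on_finite[OF fin mN] .
  have fU: "finite (\<Union>M)" "finite (\<Union>N)"
    using fin mM mN matching_on_subset by (meson finite_subset)+
  have "card M = card N"
    using M N unfolding maximum_matching_def by (meson le_antisym)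
  then have cU: "card (\<Union>M) = card (\<Union>N)"
    using card_Union_matching[OF fin] mM mN by simp
  have uvN: "{u, v} \<subseteq> \<Union>N - \<Union>M"
    using uvM uw[of N] wv[of N] N by blast
  then have "2 \<le> card (\<Union>N - \<Union>M)"
    using card_mono[OF _ uvN] fU \<open>u \<noteq> v\<close> by simp
  then have "2 \<le> card (\<Union>M - \<Union>N)"
    using cU fU by (metis card_Diff_subset_Int finite_Int inf_commute)
  \<comment> \<open>\<open>w\<close> itself lies in this difference. The exchange has to start at a
    second element, so that \<open>w\<close> remains uncovered.\<close>
  then have "\<not> \<Union>M - \<Union>N \<subseteq> {w}"
    using card_mono[of "{w}" "\<Union>M - \<Union>N"] by auto
  then obtain x where x: "x \<in> \<Union>M" "x \<notin> \<Union>N" "x \<noteq> w" by blast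
  then obtain e where e: "e \<in> M" "x \<in> e" by blast
  obtain y where y: "y \<in> A" "x \<noteq> y" "r x y" "e = {x, y}"
    using matching_edge_other[OF sym mM e] .
  have xA: "x \<in> A" using x mM matching_on_subset by blast
  have yN: "y \<in> \<Union>N"
  proof (rule ccontr)
    assume yN: "y \<notin> \<Union>N"
    have "matching_on A r (insert e N)"
      unfolding y(4) using matching_on_insert[OF mN xA y(1-3) x(2) yN] .
    moreover have "e \<notin> N" using e x by blast
    ultimately have "Suc (card N) \<le> card N"
      using N finN unfolding maximum_matching_def by (metis card_insert_disjoint)
    then show False by simp
  qed
  then obtain f where f: "f \<in> N" "y \<in> f" by blast
  have fM: "f \<notin> M"
  proof
    assume "f \<in> M"
    then have "f = e"
      using disjointD[of M f e] mM e(1) f(2) y(4) unfolding matching_on_def by auto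
    then show False using f x e by blast
  qed
  \<comment> \<open>This matching is again maximum and misses \<open>w\<close>, but compared with
    \<open>N\<close> it has gained \<open>e\<close> from \<open>M\<close> and lost only
    \<open>f\<close>, which is not in \<open>M\<close>.\<close>
  let ?N = "insert e (N - {f})"
  have dis: "y \<notin> \<Union>(N - {f})"
    using disjointD[of N f] mN f unfolding matching_on_def by blast
  have "matching_on A r ?N"
    unfolding y(4)
    by (rule matching_on_insert) (use mN matching_on_Diff xA y x dis in auto)
  moreover have "card ?N = card N"
  proof -
    have "e \<notin> N - {f}" using x e by blast
    then show ?thesis using finN f card_Suc_Diff1[of N f] by simp
  qed
  ultimately have "maximum_matching A r ?N"
    using N unfolding maximum_matching_def by simp
  moreover have "w \<notin> \<Union>?N"
    using N x yN y by auto
  ultimately have "card (M \<inter> ?N) \<le> card (M \<inter> N)"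
    using Nmax by blast
  moreover have "M \<inter> ?N = insert e (M \<inter> N)"
    using fM e by blast
  moreover have "e \<notin> M \<inter> N" using e x by blast
  ultimately show False
    using finM by simp
qed

text \<open>The nontrivial half of the Tutte--Berge formula, with adjacency-closed sets in place of odd
  components. They arise as the classes of the relation "no maximum matching misses both", which is
  transitive by Gallai's exchange argument.\<close>

lemma tutte_berge:
  assumes "finite A" and sym: "symp r"
  shows "\<exists>M S K. matching_on A r M \<and> S \<subseteq> A \<and> disjoint K \<and>
    (\<forall>C\<in>K. C \<subseteq> A - S \<and> odd (card C) \<and> (\<forall>x\<in>C. \<forall>y\<in>A - S. r x y \<longrightarrow> y \<in> C)) \<and>
    card S + card (A - \<Union>M) \<le> card K"
  using assms(1)
proof (induction "card A" arbitrary: A rule: less_induct)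
  case less
  note fin = less.prems
  show ?case
  proof (cases "\<exists>v\<in>A. \<forall>M. maximum_matching A r M \<longrightarrow> v \<in> \<Union>M")
    \<comment> \<open>No matching that avoids \<open>v\<close> is maximum, so passing from
      \<open>A - {v}\<close> to \<open>A\<close> lowers the deficiency by at least one. This pays
      for adding \<open>v\<close> to \<open>S\<close>.\<close>
    case True
    then obtain v where v: "v \<in> A" "\<And>M. maximum_matching A r M \<Longrightarrow> v \<in> \<Union>M" by blast
    obtain M0 where M0: "maximum_matching A r M0"
      using maximum_matching_exists[OF fin] .
    have "card (A - {v}) < card A" using v fin by (metis card_Diff1_less)
    from less.hyps[OF this] fin obtain M S K where IH: "matching_on (A - {v}) r M" "S \<subseteq> A - {v}"
      "disjoint K"
      "\<forall>C\<in>K. C \<subseteq> A - {v} - S \<and> odd (card C) \<and> (\<forall>x\<in>C. \<forall>y\<in>A - {v} - S. r x y \<longrightarrow> y \<in> C)"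
      "card S + card (A - {v} - \<Union>M) \<le> card K"
      by auto
    have mM: "matching_on A r M" using IH(1) matching_on_mono by blast
    have m0: "matching_on A r M0" using M0 by (simp add: maximum_matching_def)
    have UM: "\<Union>M \<subseteq> A - {v}" using matching_on_subset[OF IH(1)] .
    then have "\<not> maximum_matching A r M" using v(2) by blast
    then have "card M < card M0"
      using mM M0 unfolding maximum_matching_def by (metis le_trans not_le)
    then have "card (\<Union>M) + 2 \<le> card (\<Union>M0)"
      using card_Union_matching[OF fin] mM m0 by simp
    moreover have "card (\<Union>M0) + card (A - \<Union>M0) = card A"
      using fin matching_on_subset[OF m0]
      by (metis card_Diff_subset card_mono finite_subset le_add_diff_inverse)
    moreover have "card (\<Union>M) + card (A - {v} - \<Union>M) = card (A - {v})"
      using fin UM by (metis card_Diff_subset card_mono finite_Diff finite_subset le_add_diff_inverse)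
    moreover have "Suc (card (A - {v})) = card A"
      using fin v(1) by (metis card_Suc_Diff1)
    moreover have "card (insert v S) = Suc (card S)"
      using IH(2) fin by (metis card_insert_disjoint finite_Diff finite_subset insertCI subset_Diff_insert)
    ultimately have "card (insert v S) + card (A - \<Union>M0) \<le> card K"
      using IH(5) by linarith
    moreover have "A - insert v S = A - {v} - S" "insert v S \<subseteq> A" using IH(2) v(1) by blast+
    ultimately show ?thesis
      using m0 IH(3,4) by (intro exI[of _ M0] exI[of _ "insert v S"] exI[of _ K]) simp
  next
    case False
    define rel where "rel = (\<lambda>x y. x = y \<or> (\<forall>M. maximum_matching A r M \<longrightarrow> x \<in> \<Union>M \<or> y \<in> \<Union>M))"
    have rel_sym: "rel x y \<Longrightarrow> rel y x" for x y unfolding rel_def by blast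
    have rel_trans: "rel x z" if "rel x y" "rel y z" "y \<in> A" for x y z
    proof (cases "x = z \<or> x = y \<or> y = z")
      case True
      then show ?thesis using that rel_def by auto
    next
      case ne: False
      obtain N0 where "maximum_matching A r N0" "y \<notin> \<Union>N0" using False \<open>y \<in> A\<close> by blast
      moreover have "x \<in> \<Union>M \<or> y \<in> \<Union>M" "y \<in> \<Union>M \<or> z \<in> \<Union>M" if "maximum_matching A r M" for M
        using that \<open>rel x y\<close> \<open>rel y z\<close> ne unfolding rel_def by auto
      ultimately have "x \<in> \<Union>M \<or> z \<in> \<Union>M" if "maximum_matching A r M" for M
        using gallai_transitive[OF fin sym _ _ _ _ _ that] ne by metis
      then show ?thesis unfolding rel_def by blast
    qed
    obtain M where M: "maximum_matching A r M"
      using maximum_matching_exists[OF fin] .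
    have mM: "matching_on A r M" using M by (simp add: maximum_matching_def)
    have rel_adj: "rel x y" if xy: "x \<in> A" "y \<in> A" "r x y" for x y
    proof (rule ccontr)
      assume "\<not> rel x y"
      then obtain N where N: "x \<noteq> y" "maximum_matching A r N" "x \<notin> \<Union>N" "y \<notin> \<Union>N"
        unfolding rel_def by blast
      then have mN: "matching_on A r N" by (simp add: maximum_matching_def)
      have "matching_on A r (insert {x, y} N)"
        using matching_on_insert[OF mN] xy N by blast
      moreover have "{x, y} \<notin> N" using N by blast
      ultimately have "Suc (card N) \<le> card N"
        using N(2) matching_on_finite[OF fin mN] unfolding maximum_matching_def
        by (metis card_insert_disjoint)
      then show False by simp
    qed
    define cls where "cls = (\<lambda>x. {y \<in> A. rel x y})"
    \<comment> \<open>Here \<open>S\<close> is empty. Distinct vertices missed by \<open>M\<close>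
      are never related, so \<open>?K\<close> has exactly as many members as \<open>M\<close> misses
      vertices.\<close>
    let ?K = "cls ` (A - \<Union>M)"
    have miss: "x = y" if "x \<notin> \<Union>M" "y \<notin> \<Union>M" "rel x y" for x y
      using that M unfolding rel_def by blast
    have dj: "x = y" if "x \<in> A - \<Union>M" "y \<in> A - \<Union>M" "cls x \<inter> cls y \<noteq> {}" for x y
    proof -
      from that(3) obtain z where "z \<in> A" "rel x z" "rel y z" unfolding cls_def by blast
      then have "rel x y" using rel_trans rel_sym by blast
      then show ?thesis using miss that by blast
    qed
    have self: "x \<in> cls x" if "x \<in> A" for x using that unfolding cls_def rel_def by blast
    have "inj_on cls (A - \<Union>M)"
      by (rule inj_onI) (metis Diff_iff dj disjoint_iff self)
    then have "card ?K = card (A - \<Union>M)" by (rule card_image)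
    moreover have "disjoint ?K"
      unfolding disjoint_def using dj by blast
    moreover have closed: "z \<in> cls x" if "y \<in> cls x" "z \<in> A" "r y z" for x y z
      using that rel_trans rel_adj unfolding cls_def by blast
    moreover have "odd (card (cls x))" if x: "x \<in> A - \<Union>M" for x
    proof -
      let ?Mx = "{e \<in> M. e \<subseteq> cls x}"
      have "matching_on A r ?Mx"
        using mM unfolding matching_on_def disjoint_def by blast
      then have ev: "even (card (\<Union>?Mx))" using card_Union_matching[OF fin] by simp
      \<comment> \<open>\<open>x\<close> is the only vertex of its class missed by \<open>M\<close>,
        and the partners of the others stay in the class because it is closed.\<close>
      have "\<Union>?Mx = cls x - {x}"
      proof
        show "\<Union>?Mx \<subseteq> cls x - {x}" using x by blast
        show "cls x - {x} \<subseteq> \<Union>?Mx"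
        proof
          fix y assume y: "y \<in> cls x - {x}"
          then have "y \<in> \<Union>M" using miss[of x y] x unfolding cls_def by blast
          then obtain e where e: "e \<in> M" "y \<in> e" by blast
          then obtain z where "z \<in> A" "r y z" "e = {y, z}"
            using matching_edge_other[OF sym mM] by metis
          then show "y \<in> \<Union>?Mx" using closed y e by blast
        qed
      qed
      moreover have "finite (cls x)" using fin unfolding cls_def by simp
      moreover have "x \<in> cls x" using self x by blast
      ultimately show ?thesis
        using ev by (metis card_Suc_Diff1 even_Suc)
    qed
    moreover have "cls x \<subseteq> A" for x unfolding cls_def by blast
    ultimately show ?thesis
      using mM by (intro exI[of _ M] exI[of _ "{}"] exI[of _ ?K]) auto
  qed
qed

subsection \<open>Balanced signings of even graphs\<close>

lemma card_2_other:
  assumes "card e = 2" "x \<in> e"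
  obtains y where "e = {x, y}" "x \<noteq> y"
  using assms by (metis card_2_iff doubleton_eq_iff insertE singletonD)

definition signing :: "('e \<Rightarrow> int) \<Rightarrow> bool" where
  "signing c \<longleftrightarrow> (\<forall>e. c e = 1 \<or> c e = - 1)"

definition bal :: "('e \<Rightarrow> 'v set) \<Rightarrow> 'e set \<Rightarrow> ('e \<Rightarrow> int) \<Rightarrow> 'v \<Rightarrow> int" where
  "bal ends X c v = (\<Sum>e | e \<in> X \<and> v \<in> ends e. c e)"

lemma bal_insert:
  assumes "finite X" "e \<notin> X"
  shows "bal ends (insert e X) c v = bal ends X c v + (if v \<in> ends e then c e else 0)"
proof (cases "v \<in> ends e")
  case True
  then have "{f \<in> insert e X. v \<in> ends f} = insert e {f \<in> X. v \<in> ends f}" by blast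
  then show ?thesis using assms True by (simp add: bal_def)
next
  case False
  then have "{f \<in> insert e X. v \<in> ends f} = {f \<in> X. v \<in> ends f}" by blast
  then show ?thesis using False by (simp add: bal_def)
qed

lemma bal_Un:
  assumes "finite X" "finite Y" "X \<inter> Y = {}"
  shows "bal ends (X \<union> Y) c v = bal ends X c v + bal ends Y c v"
proof -
  have "{e \<in> X \<union> Y. v \<in> ends e} = {e \<in> X. v \<in> ends e} \<union> {e \<in> Y. v \<in> ends e}" by blast
  then show ?thesis unfolding bal_def
    using assms by (simp add: sum.union_disjoint disjoint_iff)
qed

lemma bal_uminus: "bal ends X (\<lambda>e. - c e) v = - bal ends X c v"
  by (simp add: bal_def sum_negf)

lemma signing_uminus: "signing c \<Longrightarrow> signing (\<lambda>e. - c e)"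
  by (auto simp: signing_def)

definition flip :: "'e set \<Rightarrow> ('e \<Rightarrow> int) \<Rightarrow> 'e \<Rightarrow> int" where
  "flip P c e = (if e \<in> P then - c e else c e)"

lemma signing_flip: "signing c \<Longrightarrow> signing (flip P c)"
  by (auto simp: signing_def flip_def)

lemma bal_flip:
  assumes "finite E" "P \<subseteq> E"
  shows "bal ends E (flip P c) v = bal ends E c v - 2 * bal ends P c v"
proof -
  have E: "E = (E - P) \<union> P" and fin: "finite (E - P)" "finite P"
    using assms finite_subset by auto
  have "bal ends P (flip P c) v = - bal ends P c v"
    by (simp add: bal_def flip_def sum_negf)
  moreover have "bal ends (E - P) (flip P c) v = bal ends (E - P) c v"
    unfolding bal_def by (rule sum.cong) (auto simp: flip_def)
  moreover have "bal ends E c' v = bal ends (E - P) c' v + bal ends P c' v" for c'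
    by (subst E, rule bal_Un) (use fin in auto)
  ultimately show ?thesis by simp
qed

section \<open>Signings of least imbalance\<close>

locale even_graph =
  fixes E :: "'e set" and ends :: "'e \<Rightarrow> 'v set"
  assumes fin_E: "finite E"
    and card_ends: "e \<in> E \<Longrightarrow> card (ends e) = 2"
    and even_deg: "even (card {e \<in> E. v \<in> ends e})"
begin

abbreviation b :: "('e \<Rightarrow> int) \<Rightarrow> 'v \<Rightarrow> int" where "b c v \<equiv> bal ends E c v"

definition support :: "'v set" where "support = \<Union>(ends ` E)"

definition imbalance :: "('e \<Rightarrow> int) \<Rightarrow> nat" where
  "imbalance c = nat (\<Sum>v\<in>support. \<bar>b c v\<bar>)"

definition optimal :: "('e \<Rightarrow> int) \<Rightarrow> bool" where
  "optimal c \<longleftrightarrow> signing c \<and> (\<forall>c'. signing c' \<longrightarrow> imbalance c \<le> imbalance c')"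

lemma finite_support: "finite support"
  unfolding support_def using fin_E card_ends by (metis (no_types, lifting) card.infinite finite_UN_I zero_neq_numeral)

lemma b_outside: "v \<notin> support \<Longrightarrow> b c v = 0"
  unfolding bal_def support_def by (metis (no_types, lifting) UN_I empty_Collect_eq sum.empty)

lemma even_b:
  assumes "signing c"
  shows "even (b c v)"
proof -
  have "odd (c e)" for e using assms unfolding signing_def by (metis even_minus odd_one)
  then have "even (b c v) \<longleftrightarrow> even (card {e \<in> E. v \<in> ends e})"
    unfolding bal_def by (subst even_sum_iff) (use fin_E in auto)
  then show ?thesis using even_deg by simp
qed

text \<open>\<open>P\<close> plays the role of the edge set of a maximal alternating trail from \<open>u\<close> to \<open>x\<close> in \<open>E - Q\<close>
  whose first edge is positive; \<open>s\<close> is the sign of its last edge.\<close>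

lemma maximal_alternating:
  assumes c: "signing c"
  obtains P x s where "P \<subseteq> E - Q" "s = 1 \<or> s = (- 1 :: int)"
    "\<And>v. bal ends P c v = of_bool (v = u) + s * of_bool (v = x)"
    "\<And>e. e \<in> E - Q - P \<Longrightarrow> x \<in> ends e \<Longrightarrow> c e = s"
proof -
  define ok where "ok = (\<lambda>P x s. P \<subseteq> E - Q \<and> (s = 1 \<or> s = (- 1 :: int)) \<and>
    (\<forall>v. bal ends P c v = of_bool (v = u) + s * of_bool (v = x)))"
  \<comment> \<open>The empty trail ends at \<open>u\<close> with the fictitious last sign
    \<open>- 1\<close>: the two terms at \<open>u\<close> cancel, and the next edge has to be
    positive.\<close>
  have "ok {} u (- 1)" by (simp add: ok_def bal_def)
  then have "\<exists>x s. ok {} x s" by blast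
  moreover have "\<forall>P. (\<exists>x s. ok P x s) \<longrightarrow> card P < Suc (card E)"
    unfolding ok_def by (meson Diff_subset card_mono fin_E le_imp_less_Suc subset_trans)
  ultimately obtain P where P: "\<exists>x s. ok P x s" and
    Pmax: "\<And>P'. \<exists>x s. ok P' x s \<Longrightarrow> card P' \<le> card P"
    using ex_has_greatest_nat[of "\<lambda>P. \<exists>x s. ok P x s" "{}" card "Suc (card E)"] by blast
  then obtain x s where ok: "ok P x s" by blast
  have fP: "finite P" using ok fin_E unfolding ok_def by (meson Diff_subset finite_subset)
  have "c e = s" if e: "e \<in> E - Q - P" "x \<in> ends e" for e
  proof (rule ccontr)
    assume "c e \<noteq> s"
    then have ce: "c e = - s" using c ok unfolding signing_def ok_def by (metis minus_minus)
    obtain y where y: "ends e = {x, y}" "x \<noteq> y" using card_2_other[OF card_ends] e by blast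
    have "bal ends (insert e P) c v = of_bool (v = u) + (- s) * of_bool (v = y)" for v
      using ok e y fP by (subst bal_insert) (auto simp: ok_def ce)
    then have "ok (insert e P) y (- s)" using ok e unfolding ok_def by auto
    then have "card (insert e P) \<le> card P" using Pmax by blast
    then show False using fP e by simp
  qed
  then show thesis using that ok unfolding ok_def by blast
qed

text \<open>A trail stuck at \<open>x\<close> leaves only edges of sign \<open>s\<close> there, so
  the edges outside \<open>P\<close> can push the balance of \<open>x\<close> only in direction
  \<open>s\<close>.\<close>

lemma maximal_alternating_end:
  assumes c: "signing c" and P: "P \<subseteq> E - Q" and Q: "\<And>e. e \<in> Q \<Longrightarrow> x \<notin> ends e"
    and s: "s = 1 \<or> s = (- 1 :: int)"
    and stuck: "\<And>e. e \<in> E - Q - P \<Longrightarrow> x \<in> ends e \<Longrightarrow> c e = s"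
  shows "s * b c x \<ge> s * bal ends P c x"
proof -
  have fin: "finite P" "finite (E - P)" using P fin_E finite_subset by auto
  have "b c x = bal ends (P \<union> (E - P)) c x"
    using P by (intro arg_cong[where f = "\<lambda>X. bal ends X c x"]) blast
  also have "\<dots> = bal ends P c x + bal ends (E - P) c x" by (rule bal_Un) (use fin in auto)
  also have "bal ends (E - P) c x = s * int (card {e \<in> E - P. x \<in> ends e})"
  proof -
    have "c e = s" if "e \<in> {e \<in> E - P. x \<in> ends e}" for e using stuck Q that by blast
    then show ?thesis unfolding bal_def by simp
  qed
  finally show ?thesis using s by auto
qed

lemma imbalance_two:
  assumes "u \<in> support" "x \<in> support" "u \<noteq> x" "\<And>v. v \<noteq> u \<Longrightarrow> v \<noteq> x \<Longrightarrow> b c' v = b c v"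
  shows "int (imbalance c') - int (imbalance c) = \<bar>b c' u\<bar> - \<bar>b c u\<bar> + (\<bar>b c' x\<bar> - \<bar>b c x\<bar>)"
proof -
  have "(\<Sum>v\<in>support. \<bar>b d v\<bar>) = \<bar>b d u\<bar> + \<bar>b d x\<bar> + (\<Sum>v\<in>support - {u, x}. \<bar>b d v\<bar>)" for d
    using assms(1-3) finite_support
    by (simp add: sum.remove[of support u] sum.remove[of "support - {u}" x] Diff_insert2[symmetric] insert_commute)
  moreover have "(\<Sum>v\<in>support - {u, x}. \<bar>b c' v\<bar>) = (\<Sum>v\<in>support - {u, x}. \<bar>b c v\<bar>)"
    by (rule sum.cong) (use assms(4) in auto)
  moreover have "int (imbalance d) = (\<Sum>v\<in>support. \<bar>b d v\<bar>)" for d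
    unfolding imbalance_def by (simp add: sum_nonneg)
  ultimately show ?thesis by simp
qed

lemma imbalance_one:
  assumes "u \<in> support" "\<And>v. v \<noteq> u \<Longrightarrow> b c' v = b c v"
  shows "int (imbalance c') - int (imbalance c) = \<bar>b c' u\<bar> - \<bar>b c u\<bar>"
proof -
  have "(\<Sum>v\<in>support. \<bar>b d v\<bar>) = \<bar>b d u\<bar> + (\<Sum>v\<in>support - {u}. \<bar>b d v\<bar>)" for d
    using assms(1) finite_support by (simp add: sum.remove[of support u])
  moreover have "(\<Sum>v\<in>support - {u}. \<bar>b c' v\<bar>) = (\<Sum>v\<in>support - {u}. \<bar>b c v\<bar>)"
    by (rule sum.cong) (use assms(2) in auto)
  moreover have "int (imbalance d) = (\<Sum>v\<in>support. \<bar>b d v\<bar>)" for d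
    unfolding imbalance_def by (simp add: sum_nonneg)
  ultimately show ?thesis by simp
qed

lemma optimal_uminus: "optimal c \<Longrightarrow> optimal (\<lambda>e. - c e)"
  by (simp add: optimal_def signing_uminus imbalance_def bal_uminus)

text \<open>By parity the balances at \<open>u\<close> and \<open>x\<close> are at least 2 in
  absolute value. Flipping \<open>P\<close> moves both towards 0 by 2, so \<open>c\<close> would not
  be optimal.\<close>

lemma improving_end:
  assumes c: "optimal c" and u: "b c u > 0" and "x \<noteq> u" and P: "P \<subseteq> E"
    and s: "s = 1 \<or> s = (- 1 :: int)" and x: "s * b c x \<ge> s * bal ends P c x"
    and balP: "\<And>v. bal ends P c v = of_bool (v = u) + s * of_bool (v = x)"
  shows False
proof -
  have sg: "signing c" using c by (simp add: optimal_def)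
  have "s * b c x \<ge> 1" using x balP[of x] \<open>x \<noteq> u\<close> s by auto
  moreover have "even (s * b c x)" using even_b[OF sg, of x] by simp
  moreover have "z \<ge> 2" if "z \<ge> 1" "even z" for z :: int using that by presburger
  ultimately have x1: "s * b c x \<ge> 2" by blast
  let ?c = "flip P c"
  have "b ?c v = b c v - 2 * (of_bool (v = u) + s * of_bool (v = x))" for v
    using bal_flip[OF fin_E P, of ends c v] balP by simp
  moreover have "u \<in> support" using u b_outside by force
  moreover have "b c u \<ge> 2"
    using even_b[OF sg, of u] u by presburger
  moreover have "x \<in> support" using x1 b_outside by force
  ultimately have "int (imbalance ?c) < int (imbalance c)"
    using imbalance_two[of u x ?c c] \<open>x \<noteq> u\<close> s x1 by auto
  moreover have "signing ?c" using sg by (rule signing_flip)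
  ultimately show False using c unfolding optimal_def by force
qed

text \<open>An alternating trail from \<open>u\<close> that stops elsewhere is excluded by
  \<open>improving_end\<close>. If it returns to \<open>u\<close>, flipping it lowers
  \<open>b c u\<close> by 4, an improvement as soon as \<open>b c u\<close> is at least 4.\<close>

lemma optimal_le_2_pos:
  assumes c: "optimal c"
  shows "b c u \<le> 2"
proof (rule ccontr)
  assume u: "\<not> ?thesis"
  have sg: "signing c" using c by (simp add: optimal_def)
  obtain P x s where P: "P \<subseteq> E - {}" "s = 1 \<or> s = (- 1 :: int)"
    "\<And>v. bal ends P c v = of_bool (v = u) + s * of_bool (v = x)"
    "\<And>e. e \<in> E - {} - P \<Longrightarrow> x \<in> ends e \<Longrightarrow> c e = s"
    using maximal_alternating[OF sg] by metis
  have x: "s * b c x \<ge> s * bal ends P c x"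
    using maximal_alternating_end[OF sg P(1) _ P(2) P(4)] by blast
  have xu: "x = u" using improving_end[OF c _ _ _ P(2) x P(3)] P(1) u by force
  \<comment> \<open>With \<open>s = - 1\<close> the trail would contribute 0 at \<open>u\<close>,
    and being stuck there would make \<open>b c u\<close> nonpositive.\<close>
  then have s: "s = 1" using x P(2,3) u by auto
  let ?c = "flip P c"
  have "b ?c v = b c v - 4 * of_bool (v = u)" for v
    using bal_flip[OF fin_E, of P ends c v] P(1,3) xu s by simp
  moreover have "u \<in> support" using u b_outside by force
  moreover have "b c u \<ge> 4" using even_b[OF sg, of u] u by (auto elim!: evenE)
  ultimately have "int (imbalance ?c) < int (imbalance c)"
    using imbalance_one[of u ?c c] by auto
  moreover have "signing ?c" using sg by (rule signing_flip)
  ultimately show False using c unfolding optimal_def by force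
qed

lemma optimal_le_2: "optimal c \<Longrightarrow> \<bar>b c u\<bar> \<le> 2"
  using optimal_le_2_pos[of c u] optimal_le_2_pos[OF optimal_uminus, of c u]
  by (simp add: bal_uminus abs_le_iff)

text \<open>An imbalance can be moved along any edge, even one of the wrong sign: in that case, first traverse
  a closed trail of odd length at \<open>u\<close> that avoids the edge.\<close>

lemma shift_pos:
  assumes c: "optimal c" and e: "e \<in> E" "ends e = {u, y}" "u \<noteq> y" and u: "b c u > 0"
  shows "\<exists>c'. signing c' \<and> b c' u = b c u - 2 \<and> \<bar>b c' y - b c y\<bar> = 2 \<and>
    (\<forall>v. v \<noteq> u \<longrightarrow> v \<noteq> y \<longrightarrow> b c' v = b c v)"
proof -
  have sg: "signing c" using c by (simp add: optimal_def)
  have flip: ?thesis if "P \<subseteq> E" "s = 1 \<or> s = (- 1 :: int)"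
    "\<And>v. bal ends P c v = of_bool (v = u) + s * of_bool (v = y)" for P s
    using bal_flip[OF fin_E that(1), of ends c] that(2,3) \<open>u \<noteq> y\<close> signing_flip[OF sg, of P]
    by (intro exI[of _ "flip P c"]) auto
  show ?thesis
  proof (cases "c e = 1")
    case True
    have "bal ends {e} c v = of_bool (v = u) + 1 * of_bool (v = y)" for v
      using bal_insert[of "{}" e ends c v] e True by (auto simp: bal_def)
    then show ?thesis using flip[of "{e}" 1] e by simp
  next
    case False
    then have ce: "c e = - 1" using sg unfolding signing_def by blast
    obtain P x s where P: "P \<subseteq> E - {e}" "s = 1 \<or> s = (- 1 :: int)"
      "\<And>v. bal ends P c v = of_bool (v = u) + s * of_bool (v = x)"
      "\<And>f. f \<in> E - {e} - P \<Longrightarrow> x \<in> ends f \<Longrightarrow> c f = s"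
      using maximal_alternating[OF sg] by metis
    have PE: "P \<subseteq> E" "finite P" "e \<notin> P" using P(1) fin_E finite_subset by auto
    \<comment> \<open>The trail avoids \<open>e\<close>. Ending at \<open>y\<close>, it can be
      flipped itself; ending at \<open>u\<close>, it is continued by \<open>e\<close>. Any other end
      does not lie on \<open>e\<close>, so the trail is stuck there in all of \<open>E\<close> and
      flipping it would improve \<open>c\<close>.\<close>
    consider "x = y" | "x = u" | "x \<noteq> u" "x \<noteq> y" by blast
    then show ?thesis
    proof cases
      case 1
      then show ?thesis using flip[OF PE(1) P(2)] P(3) by simp
    next
      case 3
      then have "s * b c x \<ge> s * bal ends P c x"
        using maximal_alternating_end[OF sg P(1) _ P(2) P(4)] e by auto
      then show ?thesis using improving_end[OF c u 3(1) PE(1) P(2) _ P(3)] by blast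
    next
      case 2
      \<comment> \<open>With last sign \<open>- 1\<close>, \<open>P\<close> contributes 0 at
        \<open>u\<close> and all other edges there are negative, against \<open>b c u > 0\<close>.
        As \<open>c e = - 1\<close>, this includes \<open>e\<close>, so \<open>{}\<close> can take
        the place of the avoided set.\<close>
      have "s = 1"
      proof (rule ccontr)
        assume "s \<noteq> 1"
        then have s: "s = - 1" using P(2) by blast
        have "s * b c x \<ge> s * bal ends P c x"
          by (rule maximal_alternating_end[OF sg, of P "{}"]) (use PE P(2,4) ce s in auto)
        then show False using P(3)[of x] s 2 u by simp
      qed
      then have "bal ends (insert e P) c v = of_bool (v = u) + (- 1) * of_bool (v = y)" for v
        using bal_insert[OF PE(2,3), of ends c v] P(3)[of v] ce e 2 by auto
      then show ?thesis using flip[of "insert e P" "- 1"] PE e by simp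
    qed
  qed
qed

lemma shift:
  assumes c: "optimal c" and e: "e \<in> E" "ends e = {u, y}" "u \<noteq> y" and u: "b c u \<noteq> 0"
  shows "\<exists>c'. signing c' \<and> \<bar>b c' u\<bar> = \<bar>b c u\<bar> - 2 \<and> \<bar>b c' y - b c y\<bar> = 2 \<and>
    (\<forall>v. v \<noteq> u \<longrightarrow> v \<noteq> y \<longrightarrow> b c' v = b c v)"
proof -
  have sg: "signing c" using c by (simp add: optimal_def)
  have even: "even (b c u)" using even_b[OF sg] .
  show ?thesis
  proof (cases "b c u > 0")
    case True
    then have "b c u \<ge> 2" using even by (auto elim!: evenE)
    then show ?thesis using shift_pos[OF c e True] by fastforce
  next
    case False
    then have "b c u \<le> - 2" using even u by (auto elim!: evenE)
    moreover obtain c' where "signing c'" "b c' u = - b c u - 2" "\<bar>b c' y + b c y\<bar> = 2"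
      "\<forall>v. v \<noteq> u \<longrightarrow> v \<noteq> y \<longrightarrow> b c' v = - b c v"
      using shift_pos[OF optimal_uminus[OF c] e] False u by (auto simp: bal_uminus)
    ultimately show ?thesis
      by (intro exI[of _ "\<lambda>e. - c' e"]) (auto simp: bal_uminus signing_uminus)
  qed
qed

text \<open>If an optimal \<open>c\<close> is unbalanced at \<open>u\<close>, its imbalance can be
  moved along edges to all vertices of an adjacency-closed set \<open>W\<close>, and the other
  vertices of \<open>W\<close> are balanced. So \<open>b c u\<close>, which is 2 or -2, is twice the
  sum of the signs inside \<open>W\<close>. This sum is even like the number of its edges, and 4
  would divide \<open>b c u\<close>.\<close>

theorem balanced_signing:
  assumes closed_even: "\<And>W. (\<And>e. e \<in> E \<Longrightarrow> ends e \<subseteq> W \<or> ends e \<inter> W = {}) \<Longrightarrow>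
    even (card {e \<in> E. ends e \<subseteq> W})"
  shows "\<exists>c. signing c \<and> (\<forall>v. bal ends E c v = 0)"
proof -
  have "signing (\<lambda>_. 1)" by (simp add: signing_def)
  then obtain c where c: "optimal c"
    using ex_has_least_nat[of signing "\<lambda>_. 1" imbalance] unfolding optimal_def by blast
  then have sg: "signing c" by (simp add: optimal_def)
  have "b c u = 0" for u
  proof (rule ccontr)
    assume u: "b c u \<noteq> 0"
    then have uV: "u \<in> support" using b_outside by blast
    have abs2: "\<bar>b d v\<bar> = 2" if "optimal d" "b d v \<noteq> 0" for d v
    proof -
      have "even (b d v)" using that even_b unfolding optimal_def by blast
      then show ?thesis using optimal_le_2[OF that(1), of v] that(2) by (auto elim!: evenE)
    qed
    define W where "W = {w \<in> support. w = u \<or> b c w = 0 \<and> (\<exists>d. optimal d \<and> b d w \<noteq> 0 \<and>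
      b d u = 0 \<and> (\<forall>v. v \<noteq> u \<longrightarrow> v \<noteq> w \<longrightarrow> b d v = b c v))}"
    have step: "y \<in> W" if w: "w \<in> W" and e: "e \<in> E" "ends e = {w, y}" "w \<noteq> y" for e w y
    proof (cases "y = u")
      case True
      then show ?thesis using uV by (simp add: W_def)
    next
      case False
      have yV: "y \<in> support" using e by (auto simp: support_def)
      \<comment> \<open>For \<open>w = u\<close> the signing \<open>c\<close> itself serves as
        \<open>d\<close>.\<close>
      obtain d where d: "optimal d" "b d w \<noteq> 0" "w \<noteq> u \<longrightarrow> b d u = 0 \<and> b c w = 0"
        "\<forall>v. v \<noteq> u \<longrightarrow> v \<noteq> w \<longrightarrow> b d v = b c v"
        using w c u unfolding W_def by blast
      obtain d' where d': "signing d'" "\<bar>b d' w\<bar> = \<bar>b d w\<bar> - 2" "\<bar>b d' y - b d y\<bar> = 2"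
        "\<forall>v. v \<noteq> w \<longrightarrow> v \<noteq> y \<longrightarrow> b d' v = b d v"
        using shift[OF d(1) e d(2)] by blast
      have w0: "b d' w = 0" using d' abs2[OF d(1,2)] by simp
      have dy: "b d y = b c y" using d(4) False e by blast
      have wV: "w \<in> support" using w by (simp add: W_def)
      have imb: "int (imbalance d') - int (imbalance d) = - 2 + (\<bar>b d' y\<bar> - \<bar>b d y\<bar>)"
        using imbalance_two[of w y d' d] e d' wV yV by auto
      moreover have "\<bar>b d' y\<bar> - \<bar>b d y\<bar> \<le> 2" using d'(3) by linarith
      ultimately have "imbalance d' \<le> imbalance d" by linarith
      then have opt: "optimal d'" using d(1) d'(1) unfolding optimal_def by (meson le_trans)
      then have "imbalance d' = imbalance d"
        using d(1) unfolding optimal_def by (meson le_antisym)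
      \<comment> \<open>The shift frees \<open>w\<close>, and optimality of \<open>d\<close> forces
        the same amount to reappear at \<open>y\<close>. Were \<open>y\<close> unbalanced before, it
        would now carry 4, beyond the bound 2.\<close>
      then have up: "\<bar>b d' y\<bar> = \<bar>b d y\<bar> + 2" using imb by linarith
      have "b c y = 0"
        using up dy abs2[OF d(1), of y] optimal_le_2[OF opt, of y] by force
      moreover have "b d' y \<noteq> 0" using up by linarith
      moreover have "b d' u = 0" using d(3) d'(4) w0 False e by metis
      moreover have "b d' v = b c v" if "v \<noteq> u" "v \<noteq> y" for v
        using that d(3,4) d'(4) w0 by metis
      ultimately show ?thesis using yV opt unfolding W_def by blast
    qed
    have closed: "ends e \<subseteq> W \<or> ends e \<inter> W = {}" if e: "e \<in> E" for e
    proof (cases "ends e \<inter> W = {}")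
      case False
      then obtain w where w: "w \<in> ends e" "w \<in> W" by blast
      obtain y where "ends e = {w, y}" "w \<noteq> y" using card_2_other[OF card_ends[OF e] w(1)] .
      then show ?thesis using step[OF w(2) e] w(2) by simp
    qed simp
    let ?Z = "{e \<in> E. ends e \<subseteq> W}"
    have "(\<Sum>w\<in>W. b c w) = b c u + (\<Sum>w\<in>W - {u}. b c w)"
      using finite_support uV by (intro sum.remove) (auto simp: W_def)
    also have "(\<Sum>w\<in>W - {u}. b c w) = 0"
      by (rule sum.neutral) (auto simp: W_def)
    finally have sumW: "(\<Sum>w\<in>W. b c w) = b c u" by simp
    have finW: "finite W" using finite_support by (simp add: W_def)
    \<comment> \<open>Double counting: an edge has both ends in \<open>W\<close> or none, so it is
      counted twice or never.\<close>
    have "(\<Sum>w\<in>W. b c w) = (\<Sum>w\<in>W. \<Sum>e\<in>E. if w \<in> ends e then c e else 0)"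
      unfolding bal_def using fin_E by (simp add: sum.inter_filter)
    also have "\<dots> = (\<Sum>e\<in>E. \<Sum>w\<in>W. if w \<in> ends e then c e else 0)" by (rule sum.swap)
    also have "\<dots> = (\<Sum>e\<in>E. c e * int (card (W \<inter> ends e)))"
      using finW by (simp add: sum.If_cases mult.commute Int_def)
    also have "\<dots> = (\<Sum>e\<in>E. if ends e \<subseteq> W then 2 * c e else 0)"
    proof (rule sum.cong)
      fix e assume e: "e \<in> E"
      then have "card (W \<inter> ends e) = (if ends e \<subseteq> W then 2 else 0)"
        using closed[OF e] card_ends[OF e] by (auto simp: Int_absorb1 Int_commute)
      then show "c e * int (card (W \<inter> ends e)) = (if ends e \<subseteq> W then 2 * c e else 0)" by simp
    qed simp
    also have "\<dots> = 2 * (\<Sum>e\<in>?Z. c e)"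
      using fin_E by (simp add: sum.inter_filter sum_distrib_left if_distrib cong: if_cong)
    finally have "b c u = 2 * (\<Sum>e\<in>?Z. c e)" using sumW by simp
    moreover have "even (\<Sum>e\<in>?Z. c e)"
    proof -
      have "odd (c e)" for e using sg unfolding signing_def by (metis even_minus odd_one)
      then have "even (\<Sum>e\<in>?Z. c e) \<longleftrightarrow> even (card ?Z)"
        by (subst even_sum_iff) (use fin_E in auto)
      then show ?thesis using closed_even closed by simp
    qed
    ultimately have "4 dvd b c u" by auto
    then have "4 dvd \<bar>b c u\<bar>" by simp
    then show False using abs2[OF c u] by simp
  qed
  then show ?thesis using sg by blast
qed

end

subsection \<open>Detaching the parts of a partition\<close>

text \<open>Connectedness of the subgraph formed by \<open>X\<close>, stated through cuts.\<close>

definition linked :: "('e \<Rightarrow> 'v set) \<Rightarrow> 'e set \<Rightarrow> bool" where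
  "linked ends X \<longleftrightarrow> (\<forall>W. (\<forall>e\<in>X. ends e \<subseteq> W \<or> ends e \<inter> W = {}) \<longrightarrow>
     (\<forall>e\<in>X. ends e \<subseteq> W) \<or> (\<forall>e\<in>X. ends e \<inter> W = {}))"

lemma cycle_linked:
  assumes C: "is_cycle E ends C" and ne: "\<And>e. e \<in> C \<Longrightarrow> ends e \<noteq> {}"
  shows "linked ends C"
  unfolding linked_def
proof (intro allI impI)
  fix W assume W: "\<forall>e\<in>C. ends e \<subseteq> W \<or> ends e \<inter> W = {}"
  show "(\<forall>e\<in>C. ends e \<subseteq> W) \<or> (\<forall>e\<in>C. ends e \<inter> W = {})"
  proof (cases "\<forall>e\<in>C. ends e \<inter> W = {}")
    case False
    then obtain e0 x where x: "e0 \<in> C" "x \<in> ends e0" "x \<in> W" by blast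
    have "y \<in> W" if "(adj (\<Union>(ends ` C)) C ends)\<^sup>*\<^sup>* x y" for y
      using that
    proof induction
      case base
      then show ?case using x by simp
    next
      case (step y z)
      then obtain e where "e \<in> C" "ends e = {y, z}" unfolding adj_def by blast
      then show ?case using W step by blast
    qed
    then have "ends e \<subseteq> W" if "e \<in> C" for e
      using C x(1,2) that unfolding is_cycle_def connected_graph_def by blast
    then show ?thesis by blast
  qed simp
qed

text \<open>Split along cuts until every piece is connected. A vertex keeps all its edges on one
  side of a cut, so degrees stay even.\<close>

lemma even_linked_partition:
  assumes "finite R" "\<And>e. e \<in> R \<Longrightarrow> ends e \<noteq> {}" "\<And>v. even (degree_in R ends v)"
  shows "\<exists>P. \<Union>P = R \<and> disjoint P \<and> {} \<notin> P \<and>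
    (\<forall>X\<in>P. linked ends X \<and> (\<forall>v. even (degree_in X ends v)))"
  using assms
proof (induction "card R" arbitrary: R rule: less_induct)
  case less
  consider "R = {}" | "R \<noteq> {}" "linked ends R" | "\<not> linked ends R" by blast
  then show ?case
  proof cases
    case 1
    then show ?thesis by (intro exI[of _ "{}"]) simp
  next
    case 2
    then show ?thesis using less.prems by (intro exI[of _ "{R}"]) simp
  next
    case 3
    then obtain W where W: "\<And>e. e \<in> R \<Longrightarrow> ends e \<subseteq> W \<or> ends e \<inter> W = {}"
      and ne: "\<exists>e\<in>R. \<not> ends e \<subseteq> W" "\<exists>e\<in>R. ends e \<inter> W \<noteq> {}"
      unfolding linked_def by blast
    let ?R1 = "{e \<in> R. ends e \<subseteq> W}" and ?R2 = "{e \<in> R. ends e \<inter> W = {}}"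
    have "{e \<in> ?R1. v \<in> ends e} = (if v \<in> W then {e \<in> R. v \<in> ends e} else {})" for v
      using W by auto
    then have deg1: "even (degree_in ?R1 ends v)" for v
      using less.prems(3)[of v] unfolding degree_in_def by simp
    have "{e \<in> ?R2. v \<in> ends e} = (if v \<in> W then {} else {e \<in> R. v \<in> ends e})" for v
      using W by auto
    then have deg2: "even (degree_in ?R2 ends v)" for v
      using less.prems(3)[of v] unfolding degree_in_def by simp
    have "?R1 \<subset> R" "?R2 \<subset> R" using ne by auto
    then have "card ?R1 < card R" "card ?R2 < card R"
      using less.prems(1) by (meson psubset_card_mono)+
    then obtain P1 P2 where
      P1: "\<Union>P1 = ?R1" "disjoint P1" "{} \<notin> P1"
        "\<forall>X\<in>P1. linked ends X \<and> (\<forall>v. even (degree_in X ends v))" and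
      P2: "\<Union>P2 = ?R2" "disjoint P2" "{} \<notin> P2"
        "\<forall>X\<in>P2. linked ends X \<and> (\<forall>v. even (degree_in X ends v))"
      using less.hyps[of ?R1] less.hyps[of ?R2] less.prems(1,2) deg1 deg2 by auto
    have "?R1 \<union> ?R2 = R" using W by blast
    then have "\<Union>(P1 \<union> P2) = R" using P1(1) P2(1) by simp
    moreover have "\<Union>P1 \<inter> \<Union>P2 = {}" unfolding P1(1) P2(1) using less.prems(2) by blast
    then have "disjoint (P1 \<union> P2)" using P1(2) P2(2) by (intro disjoint_union)
    ultimately show ?thesis using P1(3,4) P2(3,4) by (intro exI[of _ "P1 \<union> P2"]) auto
  qed
qed

section \<open>Weights and copies of the parts\<close>

locale even_partition =
  fixes V :: "'v set" and E :: "'e set" and ends :: "'e \<Rightarrow> 'v set" and t :: nat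
    and P Cs :: "'e set set"
  assumes fin_V: "finite V" and fin_E: "finite E"
    and ends: "e \<in> E \<Longrightarrow> ends e \<subseteq> V" "e \<in> E \<Longrightarrow> card (ends e) = 2"
    and deg: "v \<in> V \<Longrightarrow> degree_in E ends v = 2 * t" and even_t: "even t"
    and no_cut_vertex: "\<And>v U. \<lbrakk>v \<in> V; U \<subseteq> V - {v}; U \<noteq> {}; U \<noteq> V - {v}\<rbrakk> \<Longrightarrow>
      \<exists>e\<in>E. v \<notin> ends e \<and> ends e \<inter> U \<noteq> {} \<and> \<not> ends e \<subseteq> U"
    and UP: "\<Union>P = E" and disj: "disjoint P" and ne: "{} \<notin> P"
    and linked: "X \<in> P \<Longrightarrow> linked ends X"
    and even_P: "X \<in> P \<Longrightarrow> even (degree_in X ends v)"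
    and Cs: "Cs \<subseteq> P" "C \<in> Cs \<Longrightarrow> card C \<ge> 3" "C \<in> Cs \<Longrightarrow> degree_in C ends v \<le> 2"
begin

text \<open>The number of times an Euler tour of \<open>X\<close> passes through \<open>v\<close>.
  These weights add up to \<open>t\<close> over the parts at a vertex and to \<open>card X\<close>
  over the vertices.\<close>

definition half_deg :: "'e set \<Rightarrow> 'v \<Rightarrow> nat" where "half_deg X v = degree_in X ends v div 2"

definition verts :: "'e set \<Rightarrow> 'v set" where "verts X = \<Union>(ends ` X)"

text \<open>Three demands meet here: the parity of \<open>card X\<close>, at least a third of
  \<open>card X\<close>, and for a given cycle fewer copies than vertices.\<close>

definition num_copies :: "'e set \<Rightarrow> nat" where "num_copies X = (if X \<in> Cs then card X - 2 else card X)"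

definition copies :: "('e set \<times> nat) set" where "copies = (SIGMA X:P. {..<num_copies X})"

text \<open>Different copies of one part are joined too, since \<open>verts X\<close> is nonempty.
  So a closed class with one copy of \<open>X\<close> contains all copies of \<open>X\<close>
  outside \<open>S\<close>.\<close>

definition meet :: "'e set \<times> nat \<Rightarrow> 'e set \<times> nat \<Rightarrow> bool" where
  "meet a a' \<longleftrightarrow> a \<noteq> a' \<and> verts (fst a) \<inter> verts (fst a') \<noteq> {}"

lemma P_sub: "X \<in> P \<Longrightarrow> X \<subseteq> E" using UP by blast

lemma fin_P: "finite P" using UP fin_E by (metis finite_UnionD)

lemma fin_part: "X \<in> P \<Longrightarrow> finite X" using P_sub fin_E finite_subset by blast

lemma verts_sub: "X \<in> P \<Longrightarrow> verts X \<subseteq> V" using P_sub ends(1) unfolding verts_def by blast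

lemma ends_ne: "e \<in> E \<Longrightarrow> ends e \<noteq> {}"
  using ends(2)[of e] by auto

lemma verts_ne:
  assumes X: "X \<in> P"
  shows "verts X \<noteq> {}"
proof -
  obtain e where "e \<in> X" using X ne by (metis ex_in_conv)
  then show ?thesis using ends_ne[of e] P_sub[OF X] unfolding verts_def by blast
qed

lemma two_w: "X \<in> P \<Longrightarrow> 2 * half_deg X v = degree_in X ends v"
  using even_P unfolding half_deg_def by simp

lemma w_pos_iff: "X \<in> P \<Longrightarrow> half_deg X v > 0 \<longleftrightarrow> v \<in> verts X"
proof -
  assume X: "X \<in> P"
  have "half_deg X v > 0 \<longleftrightarrow> degree_in X ends v > 0" using two_w[OF X, of v] by linarith
  also have "\<dots> \<longleftrightarrow> v \<in> verts X"
    using fin_part[OF X] unfolding degree_in_def verts_def by (auto simp: card_gt_0_iff)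
  finally show ?thesis .
qed

lemma sum_w_vertices:
  assumes X: "X \<in> P" and U: "finite U" "verts X \<subseteq> U"
  shows "(\<Sum>v\<in>U. half_deg X v) = card X"
proof -
  have "(\<Sum>v\<in>U. degree_in X ends v) = (\<Sum>v\<in>U. \<Sum>e\<in>X. if v \<in> ends e then 1 else 0)"
    unfolding degree_in_def using fin_part[OF X] by (simp add: sum.If_cases Int_def)
  also have "\<dots> = (\<Sum>e\<in>X. \<Sum>v\<in>U. if v \<in> ends e then 1 else 0)" by (rule sum.swap)
  also have "\<dots> = (\<Sum>e\<in>X. 2)"
  proof (rule sum.cong)
    fix e assume e: "e \<in> X"
    then have "ends e \<subseteq> U" using U unfolding verts_def by blast
    then have "{v \<in> U. v \<in> ends e} = ends e" by blast
    then show "(\<Sum>v\<in>U. if v \<in> ends e then 1 else 0) = (2 :: nat)"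
      using U(1) ends(2)[of e] P_sub[OF X] e by (auto simp: sum.If_cases Int_def)
  qed simp
  finally have "2 * (\<Sum>v\<in>U. half_deg X v) = 2 * card X"
    by (simp add: sum_distrib_left two_w[OF X])
  then show ?thesis by simp
qed

lemma sum_degree_P: "degree_in E ends v = (\<Sum>X\<in>P. degree_in X ends v)"
proof -
  have "{e \<in> E. v \<in> ends e} = (\<Union>X\<in>P. {e \<in> X. v \<in> ends e})" using UP by blast
  moreover have "card (\<Union>X\<in>P. {e \<in> X. v \<in> ends e}) = (\<Sum>X\<in>P. card {e \<in> X. v \<in> ends e})"
    using fin_P fin_part disj disjointD[OF disj] by (intro card_UN_disjoint) fastforce+
  ultimately show ?thesis unfolding degree_in_def by simp
qed

lemma sum_w_P:
  assumes "v \<in> V"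
  shows "(\<Sum>X\<in>P. half_deg X v) = t"
proof -
  have "2 * (\<Sum>X\<in>P. half_deg X v) = (\<Sum>X\<in>P. degree_in X ends v)"
    by (simp add: sum_distrib_left two_w)
  then show ?thesis using sum_degree_P[of v] deg[OF assms] by simp
qed

lemma even_m: "X \<in> P \<Longrightarrow> even (num_copies X) \<longleftrightarrow> even (card X)"
  using Cs(2)[of X] unfolding num_copies_def by auto

lemma card_le_3m: "X \<in> P \<Longrightarrow> card X \<le> 3 * num_copies X"
  using Cs(2)[of X] unfolding num_copies_def by auto

lemma finite_copies: "finite copies" using fin_P by (simp add: copies_def)

lemma symp_meet: "symp meet" by (auto simp: symp_def meet_def)

section \<open>Tutte's condition for the copies\<close>

text \<open>The vertices of \<open>U\<close> are used only by parts of \<open>C\<close> and by parts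
  in \<open>T\<close>, so \<open>t * card U\<close> is the number of edges in the parts of
  \<open>C\<close> plus the weight of \<open>T\<close> on \<open>U\<close>. As \<open>t\<close> is
  even and that number has the parity of \<open>card C\<close>, the weight is odd. Weight 1 would
  produce a cut vertex.\<close>

lemma closed_class_weight:
  assumes C: "C \<subseteq> copies - S" "odd (card C)"
    and closed: "\<And>x y. x \<in> C \<Longrightarrow> y \<in> copies - S \<Longrightarrow> meet x y \<Longrightarrow> y \<in> C"
    and good: "\<And>X i. X \<in> fst ` C \<Longrightarrow> i < num_copies X \<Longrightarrow> (X, i) \<notin> S"
    and T: "T = {X \<in> P. \<forall>i<num_copies X. (X, i) \<in> S}"
    and U: "U = \<Union>(verts ` fst ` C)"
  shows "(\<Sum>v\<in>U. \<Sum>X\<in>T. half_deg X v) \<ge> 3"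
proof -
  let ?I = "fst ` C"
  let ?\<omega> = "\<lambda>v. \<Sum>X\<in>T. half_deg X v"
  have IP: "?I \<subseteq> P" using C(1) unfolding copies_def by auto
  have UV: "U \<subseteq> V" using U IP verts_sub by blast
  have finU: "finite U" using UV fin_V finite_subset by blast
  have finT: "finite T" using T fin_P by simp
  have IT: "?I \<inter> T = {}"
  proof -
    have "X \<notin> T" if "X \<in> ?I" for X
    proof -
      obtain i where "(X, i) \<in> C" using \<open>X \<in> ?I\<close> by force
      then have "i < num_copies X" "(X, i) \<notin> S" using C(1) unfolding copies_def by auto
      then show ?thesis using T by blast
    qed
    then show ?thesis by blast
  qed
  have inT: "X \<in> T" if X: "X \<in> P" "X \<notin> ?I" and v: "v \<in> U" "v \<in> verts X" for X v
  proof (rule ccontr)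
    assume "X \<notin> T"
    then obtain i where i: "i < num_copies X" "(X, i) \<notin> S" using T X by blast
    obtain a where a: "a \<in> C" "v \<in> verts (fst a)" using v U by blast
    have "meet a (X, i)" using a v X by (force simp: meet_def)
    then have "(X, i) \<in> C" using closed[OF a(1)] i X by (auto simp: copies_def)
    then show False using X by force
  qed
  have split: "t = (\<Sum>X\<in>?I. half_deg X v) + ?\<omega> v" if v: "v \<in> U" for v
  proof -
    have "(\<Sum>X\<in>?I \<union> T. half_deg X v) = (\<Sum>X\<in>P. half_deg X v)"
    proof (rule sum.mono_neutral_left[OF fin_P])
      show "?I \<union> T \<subseteq> P" using IP T by blast
      show "\<forall>X\<in>P - (?I \<union> T). half_deg X v = 0" using inT[OF _ _ v] w_pos_iff by blast
    qed
    moreover have "(\<Sum>X\<in>?I \<union> T. half_deg X v) = (\<Sum>X\<in>?I. half_deg X v) + ?\<omega> v"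
      using IT finT finite_subset[OF IP fin_P] by (intro sum.union_disjoint) auto
    ultimately show ?thesis using sum_w_P v UV by auto
  qed
  have "t * card U = (\<Sum>v\<in>U. t)" by (simp add: mult.commute)
  also have "\<dots> = (\<Sum>v\<in>U. (\<Sum>X\<in>?I. half_deg X v) + ?\<omega> v)"
    by (rule sum.cong) (use split in auto)
  also have "\<dots> = (\<Sum>v\<in>U. \<Sum>X\<in>?I. half_deg X v) + sum ?\<omega> U" by (rule sum.distrib)
  also have "(\<Sum>v\<in>U. \<Sum>X\<in>?I. half_deg X v) = (\<Sum>X\<in>?I. \<Sum>v\<in>U. half_deg X v)" by (rule sum.swap)
  also have "\<dots> = (\<Sum>X\<in>?I. card X)"
    using IP finU U by (intro sum.cong) (auto intro!: sum_w_vertices)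
  finally have total: "t * card U = (\<Sum>X\<in>?I. card X) + sum ?\<omega> U" .
  \<comment> \<open>By \<open>good\<close> no copy of these parts is removed, so \<open>C\<close>
    consists of complete families of copies; this ties \<open>card C\<close> to the edge
    numbers.\<close>
  have "C = (SIGMA X:?I. {..<num_copies X})"
  proof
    show "C \<subseteq> (SIGMA X:?I. {..<num_copies X})" using C(1) unfolding copies_def by force
    show "(SIGMA X:?I. {..<num_copies X}) \<subseteq> C"
    proof
      fix y assume "y \<in> (SIGMA X:?I. {..<num_copies X})"
      then obtain X j where y: "y = (X, j)" "X \<in> ?I" "j < num_copies X" by blast
      then obtain i where i: "(X, i) \<in> C" by force
      have "y \<in> copies - S" using y good IP unfolding copies_def by auto
      moreover have "meet (X, i) y \<or> (X, i) = y"
        using verts_ne IP y by (auto simp: meet_def)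
      ultimately show "y \<in> C" using closed[OF i] i by blast
    qed
  qed
  then have "card C = (\<Sum>X\<in>?I. num_copies X)"
    using finite_subset[OF IP fin_P] by (metis (no_types, lifting) card_SigmaI card_lessThan finite_lessThan sum.cong)
  moreover have "even (\<Sum>X\<in>?I. num_copies X) \<longleftrightarrow> even (\<Sum>X\<in>?I. card X)"
  proof -
    have "{X \<in> ?I. odd (num_copies X)} = {X \<in> ?I. odd (card X)}" using even_m IP by blast
    then show ?thesis using finite_subset[OF IP fin_P] by (simp add: even_sum_iff)
  qed
  ultimately have odd: "odd (sum ?\<omega> U)"
    using C(2) total even_t by (metis even_add even_mult_iff)
  moreover have "sum ?\<omega> U \<noteq> 1"
  proof
    \<comment> \<open>Then \<open>T\<close> touches \<open>U\<close> in a single vertex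
      \<open>v\<close>. The part \<open>X0\<close> leads from \<open>v\<close> to some
      \<open>z\<close> outside \<open>U\<close>, a part of \<open>C\<close> leads from
      \<open>v\<close> to some \<open>y\<close> in \<open>U - {v}\<close>, and \<open>v\<close>
      would separate \<open>y\<close> from \<open>z\<close>.\<close>
    assume one: "sum ?\<omega> U = 1"
    then have "sum ?\<omega> U \<noteq> 0" by simp
    then obtain v where v: "v \<in> U" "?\<omega> v \<noteq> 0"
      by (rule sum.not_neutral_contains_not_neutral)
    have "sum ?\<omega> U = ?\<omega> v + sum ?\<omega> (U - {v})" using finU v(1) by (rule sum.remove)
    then have "sum ?\<omega> (U - {v}) = 0" using one v(2) by linarith
    then have zero: "half_deg X x = 0" if "x \<in> U" "x \<noteq> v" "X \<in> T" for x X
      using that finU finT by simp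
    obtain X0 where X0: "X0 \<in> T" "half_deg X0 v \<noteq> 0"
      using v(2) by (rule sum.not_neutral_contains_not_neutral)
    then have X0P: "X0 \<in> P" using T by blast
    then obtain e0 where e0: "e0 \<in> X0" "v \<in> ends e0"
      using X0 w_pos_iff unfolding verts_def by blast
    then obtain z where z: "ends e0 = {v, z}" "v \<noteq> z" using card_2_other[OF ends(2)] P_sub[OF X0P] by blast
    have "z \<in> verts X0" using z e0 unfolding verts_def by blast
    then have zU: "z \<notin> U" using zero[of z X0] X0 z w_pos_iff[OF X0P, of z] by auto
    have zV: "z \<in> V" using z e0 P_sub[OF X0P] ends(1) by blast
    obtain a where a: "a \<in> C" "v \<in> verts (fst a)" using v U by blast
    then obtain e1 where e1: "e1 \<in> fst a" "v \<in> ends e1" unfolding verts_def by blast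
    have aP: "fst a \<in> P" using a IP by blast
    obtain y where y: "ends e1 = {v, y}" "v \<noteq> y" using card_2_other[OF ends(2)] e1 P_sub[OF aP] by blast
    have yU: "y \<in> U" using y e1 a U unfolding verts_def by blast
    have "v \<in> V" "U - {v} \<subseteq> V - {v}" "U - {v} \<noteq> {}" "U - {v} \<noteq> V - {v}"
      using v UV yU y zU zV z by auto
    then have "\<exists>e\<in>E. v \<notin> ends e \<and> ends e \<inter> (U - {v}) \<noteq> {} \<and> \<not> ends e \<subseteq> U - {v}"
      by (rule no_cut_vertex)
    then obtain e where e: "e \<in> E" "v \<notin> ends e" "ends e \<inter> (U - {v}) \<noteq> {}" "\<not> ends e \<subseteq> U - {v}"
      by blast
    then obtain x where x: "x \<in> ends e" "x \<in> U" "x \<noteq> v" by blast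
    obtain X where X: "X \<in> P" "e \<in> X" using UP e(1) by blast
    \<comment> \<open>\<open>e\<close> avoids \<open>v\<close>, so it has an end outside
      \<open>U\<close>, whereas the parts of \<open>C\<close> lie inside \<open>U\<close>.\<close>
    have "X \<notin> ?I" using e X U unfolding verts_def by blast
    moreover have xX: "x \<in> verts X" using x X unfolding verts_def by blast
    ultimately have "X \<in> T" using inT X(1) x(2) by blast
    then show False using zero[of x X] x xX w_pos_iff[OF X(1), of x] by auto
  qed
  moreover have "3 \<le> k" if "odd k" "k \<noteq> 1" for k :: nat using that by presburger
  ultimately show ?thesis by blast
qed

text \<open>The good classes have disjoint vertex sets, each carrying weight at least 3 of
  \<open>T\<close>, while a part in \<open>T\<close> has total weight \<open>card X\<close>, at most
  3 per copy. So there are at most as many good classes as copies of parts in \<open>T\<close>. The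
  other classes are charged to further elements of \<open>S\<close>. Hence \<open>card K\<close> is
  at most \<open>card S\<close> and nothing is left unmatched.\<close>

lemma perfect_matching: "\<exists>M. matching_on copies meet M \<and> \<Union>M = copies"
proof -
  obtain M S K where M: "matching_on copies meet M" and S: "S \<subseteq> copies" and K: "disjoint K"
    and closed: "\<forall>C\<in>K. C \<subseteq> copies - S \<and> odd (card C) \<and>
      (\<forall>x\<in>C. \<forall>y\<in>copies - S. meet x y \<longrightarrow> y \<in> C)"
    and le: "card S + card (copies - \<Union>M) \<le> card K"
    using tutte_berge[OF finite_copies symp_meet] by (elim exE conjE) (rule that)
  note KC = bspec[OF closed]
  define T where "T = {X \<in> P. \<forall>i<num_copies X. (X, i) \<in> S}"
  define U where "U = (\<lambda>C :: ('e set \<times> nat) set. \<Union>(verts ` fst ` C))"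
  define good where "good = {C \<in> K. \<forall>X\<in>fst ` C. \<forall>i<num_copies X. (X, i) \<notin> S}"
  have fin_S: "finite S" using S finite_copies finite_subset by blast
  have fin_T: "finite T" "T \<subseteq> P" using fin_P by (auto simp: T_def)
  have "K \<subseteq> Pow copies" using KC by blast
  then have fin_K: "finite K" using finite_copies finite_subset by blast
  have inP: "X \<in> P" if "X \<in> fst ` C" "C \<in> K" for X C
    using that KC[of C] unfolding copies_def by auto
  \<comment> \<open>Two copies at a common vertex are equal or joined, and the classes are closed
    and disjoint.\<close>
  have same: "C = C'" if CC: "C \<in> K" "C' \<in> K" and v: "v \<in> U C" "v \<in> U C'" for C C' v
  proof -
    obtain a a' where a: "a \<in> C" "v \<in> verts (fst a)" "a' \<in> C'" "v \<in> verts (fst a')"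
      using v unfolding U_def by blast
    have "a = a' \<or> meet a a'" using a by (auto simp: meet_def)
    moreover have "a' \<in> copies - S" using KC[OF CC(2)] a by blast
    ultimately have "a' \<in> C" using KC[OF CC(1)] a by blast
    then show ?thesis using a(3) CC disjointD[OF K] by blast
  qed
  have same_fst: "C = C'" if CC: "C \<in> K" "C' \<in> K" and X: "X \<in> fst ` C" "X \<in> fst ` C'" for C C' X
  proof -
    obtain v where "v \<in> verts X" using verts_ne[OF inP[OF X(1) CC(1)]] by blast
    then have "v \<in> U C" "v \<in> U C'" using X unfolding U_def by blast+
    then show ?thesis by (rule same[OF CC])
  qed
  have U_V: "U C \<subseteq> V" if "C \<in> K" for C
  proof -
    have "verts X \<subseteq> V" if "X \<in> fst ` C" for X
      using verts_sub[OF inP[OF that \<open>C \<in> K\<close>]] .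
    then show ?thesis unfolding U_def by blast
  qed
  have "3 * card good \<le> (\<Sum>C\<in>good. \<Sum>v\<in>U C. \<Sum>X\<in>T. half_deg X v)"
  proof -
    have "3 \<le> (\<Sum>v\<in>U C. \<Sum>X\<in>T. half_deg X v)" if C: "C \<in> good" for C
    proof (rule closed_class_weight)
      have CK: "C \<in> K" using C by (simp add: good_def)
      show "C \<subseteq> copies - S" "odd (card C)" using KC[OF CK] by auto
      show "\<And>x y. x \<in> C \<Longrightarrow> y \<in> copies - S \<Longrightarrow> meet x y \<Longrightarrow> y \<in> C" using KC[OF CK] by blast
      show "\<And>X i. X \<in> fst ` C \<Longrightarrow> i < num_copies X \<Longrightarrow> (X, i) \<notin> S" using C unfolding good_def by blast
    qed (simp_all add: T_def U_def)
    then have "(\<Sum>C\<in>good. 3) \<le> (\<Sum>C\<in>good. \<Sum>v\<in>U C. \<Sum>X\<in>T. half_deg X v)" by (rule sum_mono)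
    then show ?thesis by simp
  qed
  also have "\<dots> = (\<Sum>v\<in>(\<Union>C\<in>good. U C). \<Sum>X\<in>T. half_deg X v)"
  proof (rule sum.UNION_disjoint[symmetric])
    show "finite good" using fin_K by (simp add: good_def)
    show "\<forall>C\<in>good. finite (U C)" using finite_subset[OF U_V fin_V] unfolding good_def by blast
    show "\<forall>C\<in>good. \<forall>C'\<in>good. C \<noteq> C' \<longrightarrow> U C \<inter> U C' = {}" using same unfolding good_def by blast
  qed
  also have "\<dots> \<le> (\<Sum>v\<in>V. \<Sum>X\<in>T. half_deg X v)"
    using U_V fin_V by (intro sum_mono2) (auto simp: good_def)
  also have "\<dots> = (\<Sum>X\<in>T. \<Sum>v\<in>V. half_deg X v)" by (rule sum.swap)
  also have "\<dots> \<le> (\<Sum>X\<in>T. 3 * num_copies X)"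
  proof (rule sum_mono)
    fix X assume "X \<in> T"
    then have "X \<in> P" using fin_T by blast
    then show "(\<Sum>v\<in>V. half_deg X v) \<le> 3 * num_copies X"
      using sum_w_vertices fin_V verts_sub card_le_3m by simp
  qed
  also have "\<dots> = 3 * card (SIGMA X:T. {..<num_copies X})"
    using fin_T by (simp add: sum_distrib_left)
  finally have card_good: "card good \<le> card (SIGMA X:T. {..<num_copies X})" by simp
  have "\<forall>C\<in>K - good. \<exists>a\<in>S. fst a \<in> fst ` C" unfolding good_def by force
  \<comment> \<open>\<open>h C\<close> is a removed copy of a part that still has a copy in
    \<open>C\<close>. Such a part is only partly removed, hence not in \<open>T\<close>, and it
    occurs in no other class.\<close>
  then obtain h where h: "\<And>C. C \<in> K - good \<Longrightarrow> h C \<in> S \<and> fst (h C) \<in> fst ` C" by metis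
  have "inj_on h (K - good)"
    using h same_fst by (intro inj_onI) (metis Diff_iff)
  then have card_bad: "card (K - good) = card (h ` (K - good))" by (simp add: card_image)
  have "(SIGMA X:T. {..<num_copies X}) \<inter> h ` (K - good) = {}"
  proof -
    have "fst (h C) \<notin> T" if C: "C \<in> K - good" for C
    proof -
      obtain i where i: "(fst (h C), i) \<in> C" using h[OF C] by force
      then have "(fst (h C), i) \<in> copies - S" using KC[of C] C by blast
      then show ?thesis unfolding T_def copies_def by auto
    qed
    then have "a \<notin> h ` (K - good)" if "a \<in> (SIGMA X:T. {..<num_copies X})" for a
      using that by (metis SigmaE fst_conv imageE)
    then show ?thesis by blast
  qed
  moreover have "(SIGMA X:T. {..<num_copies X}) \<union> h ` (K - good) \<subseteq> S"
    using h by (auto simp: T_def)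
  ultimately have "card (SIGMA X:T. {..<num_copies X}) + card (h ` (K - good)) \<le> card S"
    using fin_S fin_T fin_K
    by (metis card_Un_disjoint card_mono finite_Un finite_subset)
  moreover have "card K = card good + card (K - good)"
    using fin_K by (metis (no_types, lifting) card_Diff_subset card_mono good_def le_add_diff_inverse
        mem_Collect_eq rev_finite_subset subsetI)
  ultimately have "card K \<le> card S" using card_good card_bad by linarith
  then have "card (copies - \<Union>M) = 0" using le by linarith
  then have "copies \<subseteq> \<Union>M" using finite_copies by simp
  then show ?thesis using M matching_on_subset[OF M] by blast
qed

section \<open>From the matching to the factor\<close>

text \<open>\<open>n X v\<close> counts the copies of \<open>X\<close> whose matched pair has chosen
  the common vertex \<open>v\<close>. The copies choosing \<open>v\<close> form whole pairs, whence
  the even sum.\<close>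

lemma transition_numbers:
  "\<exists>n. (\<forall>X\<in>P. (\<Sum>v\<in>V. n X v) = num_copies X) \<and> (\<forall>v. even (\<Sum>X\<in>P. n X v)) \<and>
    (\<forall>X\<in>P. \<forall>v. n X v \<noteq> (0 :: nat) \<longrightarrow> v \<in> verts X)"
proof -
  obtain M where M: "matching_on copies meet M" "\<Union>M = copies"
    using perfect_matching by blast
  have "\<exists>v. \<forall>a\<in>e. v \<in> verts (fst a)" if "e \<in> M" for e
    using M(1) that unfolding matching_on_def meet_def by fastforce
  then obtain vtx where vtx: "\<And>e a. e \<in> M \<Longrightarrow> a \<in> e \<Longrightarrow> vtx e \<in> verts (fst a)" by metis
  have "\<forall>a\<in>copies. \<exists>e\<in>M. a \<in> e" using M(2) by blast
  then obtain edge where edge: "\<And>a. a \<in> copies \<Longrightarrow> edge a \<in> M \<and> a \<in> edge a" by metis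
  have edge_eq: "edge a = e" if "e \<in> M" "a \<in> e" for a e
    using edge[of a] that M disjointD[of M e "edge a"] unfolding matching_on_def by blast
  define g where "g a = vtx (edge a)" for a
  have g: "g (X, i) \<in> verts X" if "X \<in> P" "i < num_copies X" for X i
    using vtx[of "edge (X, i)" "(X, i)"] edge[of "(X, i)"] that unfolding g_def copies_def by simp
  define n where "n = (\<lambda>X v. card {i \<in> {..<num_copies X}. g (X, i) = v})"
  have "(\<Sum>v\<in>V. n X v) = num_copies X" if X: "X \<in> P" for X
  proof -
    have "(\<Sum>v\<in>V. n X v) = card (\<Union>v\<in>V. {i \<in> {..<num_copies X}. g (X, i) = v})"
      unfolding n_def using fin_V by (intro card_UN_disjoint[symmetric]) auto
    also have "(\<Union>v\<in>V. {i \<in> {..<num_copies X}. g (X, i) = v}) = {..<num_copies X}"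
      using g[OF X] verts_sub[OF X] by auto
    finally show ?thesis by simp
  qed
  moreover have "even (\<Sum>X\<in>P. n X v)" for v
  proof -
    have "(\<Sum>X\<in>P. n X v) = card (SIGMA X:P. {i \<in> {..<num_copies X}. g (X, i) = v})"
      unfolding n_def using fin_P by simp
    also have "(SIGMA X:P. {i \<in> {..<num_copies X}. g (X, i) = v}) = {a \<in> copies. g a = v}"
      unfolding copies_def by auto
    also have "\<dots> = \<Union>{e \<in> M. vtx e = v}"
      using edge edge_eq M(2) unfolding g_def by blast
    also have "even (card \<dots>)"
    proof -
      have "M - {e \<in> M. vtx e \<noteq> v} = {e \<in> M. vtx e = v}" by blast
      then have "matching_on copies meet {e \<in> M. vtx e = v}"
        using matching_on_Diff[OF M(1), of "{e \<in> M. vtx e \<noteq> v}"] by simp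
      then show ?thesis using card_Union_matching[OF finite_copies] by simp
    qed
    finally show ?thesis .
  qed
  moreover have "v \<in> verts X" if X: "X \<in> P" and "n X v \<noteq> 0" for X v
  proof -
    have "{i \<in> {..<num_copies X}. g (X, i) = v} \<noteq> {}" using that(2) unfolding n_def by (metis card.empty)
    then show ?thesis using g[OF X] by blast
  qed
  ultimately show ?thesis by blast
qed

text \<open>A balanced signing of the detached graph stays balanced when the vertices
  \<open>(v, Z)\<close> are merged back into \<open>v\<close>, so its positive edges form the
  factor. Where a given cycle is detached, only its own edges meet, so it receives both
  signs.\<close>

theorem balanced_factor:
  "\<exists>F\<subseteq>E. (\<forall>v\<in>V. degree_in F ends v = t) \<and> (\<forall>C\<in>Cs. C \<inter> F \<noteq> {} \<and> C \<inter> (E - F) \<noteq> {})"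
proof -
  obtain n :: "'e set \<Rightarrow> 'v \<Rightarrow> nat" where n_m: "\<And>X. X \<in> P \<Longrightarrow> (\<Sum>v\<in>V. n X v) = num_copies X"
    and n_even: "\<And>v. even (\<Sum>X\<in>P. n X v)"
    and n_verts: "\<And>X v. X \<in> P \<Longrightarrow> n X v \<noteq> 0 \<Longrightarrow> v \<in> verts X"
    using transition_numbers by blast
  \<comment> \<open>\<open>(v, {})\<close> is what remains of \<open>v\<close>, and \<open>(v, X)\<close> the vertex at which \<open>X\<close> is detached from \<open>v\<close>.\<close>
  define site where "site = (\<lambda>X v. (v, if odd (n X v) then {} else X))"
  have "\<forall>e\<in>E. \<exists>X\<in>P. e \<in> X" using UP by blast
  then obtain part where part: "\<And>e. e \<in> E \<Longrightarrow> part e \<in> P \<and> e \<in> part e" by metis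
  have part_eq: "part e = X" if "X \<in> P" "e \<in> X" for e X
    using part[of e] that UP disjointD[OF disj, of "part e" X] by blast
  define ends' where "ends' e = site (part e) ` ends e" for e
  have ends'_X: "ends' e = site X ` ends e" if "X \<in> P" "e \<in> X" for e X
    using part_eq[OF that] by (simp add: ends'_def)
  \<comment> \<open>Within one part detaching is an injective renaming of vertices, so every edge
    keeps two ends.\<close>
  have inj: "inj_on (site X) A" for X A by (rule inj_onI) (simp add: site_def)
  have at_main: "{e \<in> E. (v, {}) \<in> ends' e} =
    (\<Union>X\<in>{X \<in> P. odd (n X v)}. {e \<in> X. v \<in> ends e})" for v
  proof -
    have "(v, {}) \<in> ends' e \<longleftrightarrow> v \<in> ends e \<and> odd (n X v)" if "X \<in> P" "e \<in> X" for e X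
      unfolding ends'_X[OF that] using that by (auto simp: site_def image_iff split: if_splits)
    then show ?thesis using UP by blast
  qed
  have at_split: "{e \<in> E. (v, X) \<in> ends' e} =
    (if X \<in> P \<and> even (n X v) then {e \<in> X. v \<in> ends e} else {})" if "X \<noteq> {}" for v X
  proof -
    have "(v, X) \<in> ends' e \<longleftrightarrow> v \<in> ends e \<and> even (n Y v) \<and> X = Y" if "Y \<in> P" "e \<in> Y" for e Y
      unfolding ends'_X[OF that] using \<open>X \<noteq> {}\<close> by (auto simp: site_def image_iff split: if_splits)
    then show ?thesis using UP by auto
  qed
  interpret H: even_graph E ends'
  proof
    show "finite E" by (rule fin_E)
    show "card (ends' e) = 2" if "e \<in> E" for e
      unfolding ends'_def using ends(2)[OF that] inj by (simp add: card_image)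
    fix x :: "'v \<times> 'e set"
    obtain v X where x: "x = (v, X)" by (cases x)
    show "even (card {e \<in> E. x \<in> ends' e})"
    proof (cases "X = {}")
      case True
      have "card {e \<in> E. x \<in> ends' e} = (\<Sum>X\<in>{X \<in> P. odd (n X v)}. degree_in X ends v)"
        unfolding x True at_main degree_in_def
        using fin_P fin_part disjointD[OF disj] by (intro card_UN_disjoint) fastforce+
      then show ?thesis using even_P by (auto intro!: dvd_sum)
    next
      case False
      then show ?thesis
        unfolding x at_split[OF False] using even_P by (simp add: degree_in_def[symmetric])
    qed
  qed
  have "\<exists>c. signing c \<and> (\<forall>x. bal ends' E c x = 0)"
  proof (rule H.balanced_signing)
    fix W assume W: "\<And>e. e \<in> E \<Longrightarrow> ends' e \<subseteq> W \<or> ends' e \<inter> W = {}"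
    define Z where "Z = {X \<in> P. \<forall>e\<in>X. ends' e \<subseteq> W}"
    have Z: "ends' e \<subseteq> W \<longleftrightarrow> X \<in> Z" if X: "X \<in> P" "e \<in> X" for X e
    proof -
      \<comment> \<open>Pulled back along \<open>site X\<close>, \<open>W\<close> becomes a cut that
        no edge of \<open>X\<close> crosses, so \<open>linked\<close> puts \<open>X\<close> wholly
        inside or wholly outside.\<close>
      let ?W = "{v. site X v \<in> W}"
      have sub: "ends' f \<subseteq> W \<longleftrightarrow> ends f \<subseteq> ?W" "ends' f \<inter> W = {} \<longleftrightarrow> ends f \<inter> ?W = {}"
        if "f \<in> X" for f using ends'_X[OF X(1) that] by auto
      then have "\<forall>f\<in>X. ends f \<subseteq> ?W \<or> ends f \<inter> ?W = {}" using W P_sub[OF X(1)] by blast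
      then have "(\<forall>f\<in>X. ends f \<subseteq> ?W) \<or> (\<forall>f\<in>X. ends f \<inter> ?W = {})"
        using linked[OF X(1)] unfolding linked_def by blast
      moreover have "ends f \<noteq> {}" if "f \<in> X" for f using ends_ne P_sub[OF X(1)] that by blast
      ultimately show ?thesis unfolding Z_def using sub X by blast
    qed
    have ZP: "Z \<subseteq> P" "finite Z" using fin_P by (auto simp: Z_def)
    have "{e \<in> E. ends' e \<subseteq> W} = \<Union>Z" using Z UP ZP(1) by blast
    then have "card {e \<in> E. ends' e \<subseteq> W} = (\<Sum>X\<in>Z. card X)"
      using ZP fin_part disj by (auto intro!: card_Union_disjoint elim: pairwise_subset simp: subset_iff)
    \<comment> \<open>Modulo 2 the number of edges in \<open>W\<close> becomes a sum of the
      \<open>n X v\<close>, whose parity can be checked vertex by vertex.\<close>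
    moreover have "even (\<Sum>X\<in>Z. card X) \<longleftrightarrow> even (\<Sum>X\<in>Z. num_copies X)"
    proof -
      have "{X \<in> Z. odd (num_copies X)} = {X \<in> Z. odd (card X)}" using even_m ZP by blast
      then show ?thesis using ZP by (simp add: even_sum_iff)
    qed
    moreover have "(\<Sum>X\<in>Z. num_copies X) = (\<Sum>X\<in>Z. \<Sum>v\<in>V. n X v)" using n_m ZP by (intro sum.cong) auto
    moreover have "\<dots> = (\<Sum>v\<in>V. \<Sum>X\<in>Z. n X v)" by (rule sum.swap)
    moreover have "even (\<Sum>v\<in>V. \<Sum>X\<in>Z. n X v)"
    proof (rule dvd_sum)
      fix v
      \<comment> \<open>An odd \<open>n X v\<close> is nonzero, so \<open>X\<close> has an edge at
        \<open>(v, {})\<close>. All parts attached at \<open>v\<close> are thus together inside or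
        together outside \<open>W\<close>, and \<open>n_even\<close> applies.\<close>
      have in_W: "X \<in> Z \<longleftrightarrow> (v, {}) \<in> W" if X: "X \<in> P" "odd (n X v)" for X
      proof -
        have "n X v \<noteq> 0" using X(2) by (metis even_zero)
        then obtain e where e: "e \<in> X" "v \<in> ends e" using n_verts[OF X(1)] unfolding verts_def by blast
        have "(v, {}) \<in> ends' e" using ends'_X[OF X(1) e(1)] e(2) X(2) by (force simp: site_def)
        then show ?thesis using Z[OF X(1) e(1)] W[of e] e(1) P_sub[OF X(1)] by blast
      qed
      show "even (\<Sum>X\<in>Z. n X v)"
      proof (cases "(v, {}) \<in> W")
        case True
        then have "{X \<in> Z. odd (n X v)} = {X \<in> P. odd (n X v)}" using in_W ZP by blast
        then show ?thesis using n_even[of v] ZP fin_P by (simp add: even_sum_iff)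
      next
        case False
        then have "even (n X v)" if "X \<in> Z" for X using in_W[of X] that ZP by blast
        then show ?thesis by (auto intro!: dvd_sum)
      qed
    qed
    ultimately show "even (card {e \<in> E. ends' e \<subseteq> W})" by simp
  qed
  then obtain c where c: "signing c" and bal: "\<And>x. bal ends' E c x = 0" by blast
  have c_val: "c e = 1 \<or> c e = - 1" for e using c by (simp add: signing_def)
  define F where "F = {e \<in> E. c e = 1}"
  have "degree_in F ends v = t" if v: "v \<in> V" for v
  proof -
    let ?A = "\<lambda>Z. {e \<in> E. (v, Z) \<in> ends' e}"
    \<comment> \<open>The edges at \<open>v\<close> are distributed among the vertices
      \<open>(v, Z)\<close>, where all balances vanish, so half of the \<open>2 * t\<close> edges
      are positive.\<close>
    have "{e \<in> E. v \<in> ends e} = (\<Union>Z\<in>insert {} P. ?A Z)"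
    proof -
      have "v \<in> ends e \<longleftrightarrow> (\<exists>Z\<in>insert {} P. (v, Z) \<in> ends' e)" if "e \<in> E" for e
        using part[OF that] unfolding ends'_def site_def by (auto simp: image_iff)
      then show ?thesis by blast
    qed
    then have "(\<Sum>e | e \<in> E \<and> v \<in> ends e. c e) = (\<Sum>e\<in>(\<Union>Z\<in>insert {} P. ?A Z). c e)" by simp
    also have "\<dots> = (\<Sum>Z\<in>insert {} P. \<Sum>e\<in>?A Z. c e)"
    proof (rule sum.UNION_disjoint)
      show "\<forall>Z\<in>insert {} P. \<forall>Z'\<in>insert {} P. Z \<noteq> Z' \<longrightarrow> ?A Z \<inter> ?A Z' = {}"
        unfolding ends'_def site_def by auto
    qed (use fin_P fin_E in auto)
    also have "\<dots> = 0" using bal unfolding bal_def by simp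
    finally have zero: "(\<Sum>e | e \<in> E \<and> v \<in> ends e. c e) = 0" .
    let ?F = "{e \<in> F. v \<in> ends e}" and ?G = "{e \<in> E - F. v \<in> ends e}"
    have split: "{e \<in> E. v \<in> ends e} = ?F \<union> ?G" "?F \<inter> ?G = {}" "finite ?F" "finite ?G"
      using fin_E by (auto simp: F_def)
    have "(\<Sum>e\<in>?F. c e) = (\<Sum>e\<in>?F. 1)" by (rule sum.cong) (auto simp: F_def)
    moreover have "(\<Sum>e\<in>?G. c e) = (\<Sum>e\<in>?G. - 1)"
      by (rule sum.cong) (use c_val in \<open>auto simp: F_def\<close>)
    ultimately have "card ?F = card ?G"
      using zero unfolding split(1) sum.union_disjoint[OF split(3,4,2)] by simp
    moreover have "card ?F + card ?G = 2 * t"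
      using deg[OF v] card_Un_disjoint[OF split(3,4,2)] split(1) unfolding degree_in_def by simp
    ultimately show ?thesis unfolding degree_in_def by simp
  qed
  moreover have "C \<inter> F \<noteq> {} \<and> C \<inter> (E - F) \<noteq> {}" if C: "C \<in> Cs" for C
  proof -
    have CP: "C \<in> P" using C Cs(1) by blast
    have Cne: "C \<noteq> {}" using CP ne by blast
    \<comment> \<open>Otherwise \<open>n C v\<close> is at least 1 at every vertex of
      \<open>C\<close>, which would require at least \<open>card C\<close> copies instead of
      \<open>card C - 2\<close>.\<close>
    have "\<exists>v\<in>verts C. even (n C v)"
    proof (rule ccontr)
      assume odd: "\<not> ?thesis"
      have fv: "finite (verts C)" using verts_sub[OF CP] fin_V finite_subset by blast
      have "card C = (\<Sum>v\<in>verts C. half_deg C v)" using sum_w_vertices[OF CP fv] by simp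
      also have "\<dots> \<le> (\<Sum>v\<in>verts C. n C v)"
      proof (rule sum_mono)
        fix v assume "v \<in> verts C"
        then have "n C v \<noteq> 0" using odd by (metis even_zero)
        moreover have "half_deg C v \<le> 1" using Cs(3)[OF C, of v] unfolding half_deg_def by simp
        ultimately show "half_deg C v \<le> n C v" by linarith
      qed
      also have "\<dots> \<le> (\<Sum>v\<in>V. n C v)" using verts_sub[OF CP] fin_V by (intro sum_mono2) auto
      also have "\<dots> = card C - 2" using n_m[OF CP] C by (simp add: num_copies_def)
      finally show False using Cs(2)[OF C] by simp
    qed
    then obtain v where v: "v \<in> verts C" "even (n C v)" by blast
    let ?D = "{e \<in> C. v \<in> ends e}"
    have D: "?D \<noteq> {}" "finite ?D" using v(1) fin_part[OF CP] unfolding verts_def by auto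
    have "(\<Sum>e\<in>?D. c e) = 0"
      using bal[of "(v, C)"] at_split[OF Cne, of v] CP v(2) unfolding bal_def by simp
    moreover have "(\<Sum>e\<in>?D. c e) = (\<Sum>e\<in>?D. k)" if "\<forall>e\<in>C. c e = k" for k
      by (rule sum.cong) (use that in auto)
    moreover have "card ?D > 0" using D by (simp add: card_gt_0_iff)
    \<comment> \<open>With constant sign \<open>k\<close> on \<open>C\<close>, the balance at
      \<open>(v, C)\<close> is a positive multiple of \<open>k\<close>.\<close>
    ultimately have const: "k = 0" if "\<forall>e\<in>C. c e = k" for k
      using that by simp
    have "\<exists>e\<in>C. c e \<noteq> 1" "\<exists>f\<in>C. c f \<noteq> - 1"
      using const[of 1] const[of "- 1"] by auto
    then obtain e f where "e \<in> C" "c e \<noteq> 1" "f \<in> C" "c f \<noteq> - 1" by blast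
    then have "e \<in> C \<inter> (E - F)" "f \<in> C \<inter> F"
      using P_sub[OF CP] c_val[of f] unfolding F_def by auto
    then show ?thesis by blast
  qed
  ultimately show ?thesis by (intro exI[of _ F]) (auto simp: F_def)
qed

end

section \<open>The partition into the given cycles and connected even pieces of the rest\<close>

theorem theorem6p5:
  fixes V :: "'v set" and E :: "'e set" and ends :: "'e \<Rightarrow> 'v set"
    and t :: nat and Cs :: "'e set set"
  assumes "multigraph V E ends"
    and "even t" and "t \<ge> 2"
    and "three_connected V E ends"
    and "regular V E ends (2 * t)"
    and "\<forall>C\<in>Cs. is_cycle E ends C \<and> card C \<ge> 3"
    and "\<forall>C1\<in>Cs. \<forall>C2\<in>Cs. C1 \<noteq> C2 \<longrightarrow> C1 \<inter> C2 = {}"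
  shows "\<exists>F. is_factor V E ends t F \<and>
           (\<forall>C\<in>Cs. C \<inter> F \<noteq> {} \<and> C \<inter> (E - F) \<noteq> {})"
proof -
  have fin: "finite V" "finite E" and ends: "\<And>e. e \<in> E \<Longrightarrow> ends e \<subseteq> V" "\<And>e. e \<in> E \<Longrightarrow> card (ends e) = 2"
    using assms(1) by (auto simp: multigraph_def)
  have ends_ne: "ends e \<noteq> {}" if "e \<in> E" for e using ends(2)[OF that] by auto
  have CE: "C \<subseteq> E" if "C \<in> Cs" for C using assms(6) that by (simp add: is_cycle_def)
  have fin_Cs: "finite Cs" using CE fin(2) by (meson PowI finite_Pow_iff finite_subset subsetI)
  have deg_C: "degree_in C ends v = (if v \<in> \<Union>(ends ` C) then 2 else 0)" if "C \<in> Cs" for C v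
    using assms(6) that unfolding is_cycle_def regular_def
    by (auto simp: degree_in_def) (metis (no_types, lifting) card.empty empty_Collect_eq)
  have dCs: "disjoint Cs" using assms(7) by (auto simp: disjoint_def)
  let ?R = "E - \<Union>Cs"
  \<comment> \<open>All degrees in \<open>E\<close> are even by regularity, and each cycle takes 0
    or 2 edges at a vertex.\<close>
  have even_R: "even (degree_in ?R ends v)" for v
  proof -
    have "{e \<in> E. v \<in> ends e} = {e \<in> ?R. v \<in> ends e} \<union> (\<Union>C\<in>Cs. {e \<in> C. v \<in> ends e})"
      using CE by blast
    moreover have "card (\<Union>C\<in>Cs. {e \<in> C. v \<in> ends e}) = (\<Sum>C\<in>Cs. degree_in C ends v)"
      unfolding degree_in_def
      using fin_Cs CE fin(2) finite_subset disjointD[OF dCs]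
      by (intro card_UN_disjoint) fastforce+
    moreover have "card ({e \<in> ?R. v \<in> ends e} \<union> (\<Union>C\<in>Cs. {e \<in> C. v \<in> ends e})) =
      degree_in ?R ends v + card (\<Union>C\<in>Cs. {e \<in> C. v \<in> ends e})"
      unfolding degree_in_def
      using fin CE by (intro card_Un_disjoint) (auto intro: finite_subset)
    ultimately have "degree_in E ends v = degree_in ?R ends v + (\<Sum>C\<in>Cs. degree_in C ends v)"
      unfolding degree_in_def by simp
    moreover have "even (\<Sum>C\<in>Cs. degree_in C ends v)" using deg_C by (auto intro!: dvd_sum)
    moreover have "even (degree_in E ends v)"
    proof (cases "v \<in> V")
      case True
      then show ?thesis using assms(5) by (simp add: regular_def)
    next
      case False
      then have "{e \<in> E. v \<in> ends e} = {}" using ends(1) by blast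
      then show ?thesis by (simp only: degree_in_def card.empty even_zero)
    qed
    ultimately show ?thesis by simp
  qed
  obtain Q where Q: "\<Union>Q = ?R" "disjoint Q" "{} \<notin> Q"
    "\<forall>X\<in>Q. linked ends X \<and> (\<forall>v. even (degree_in X ends v))"
    using even_linked_partition[of ?R ends] fin ends_ne even_R by blast
  interpret even_partition V E ends t "Cs \<union> Q" Cs
  proof
    fix v U assume U: "v \<in> V" "U \<subseteq> V - {v}" "U \<noteq> {}" "U \<noteq> V - {v}"
    let ?E = "{e \<in> E. ends e \<inter> {v} = {}}"
    have "connected_graph (V - {v}) ?E ends"
      using assms(4) U(1) unfolding three_connected_def by (elim conjE allE[of _ "{v}"]) simp
    moreover obtain x y where xy: "x \<in> U" "y \<in> V - {v}" "y \<notin> U" using U by blast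
    ultimately have "(adj (V - {v}) ?E ends)\<^sup>*\<^sup>* x y" using U unfolding connected_graph_def by blast
    \<comment> \<open>A path avoiding \<open>v\<close> from \<open>x\<close> in \<open>U\<close> to
      \<open>y\<close> outside \<open>U\<close> has a step that leaves \<open>U\<close>.\<close>
    then show "\<exists>e\<in>E. v \<notin> ends e \<and> ends e \<inter> U \<noteq> {} \<and> \<not> ends e \<subseteq> U"
      using xy(3)
    proof (induction rule: rtranclp_induct)
      case base
      then show ?case using xy by simp
    next
      case (step y z)
      then show ?case unfolding adj_def by (cases "y \<in> U") auto
    qed
  next
    show "disjoint (Cs \<union> Q)"
      using dCs Q(2) by (rule disjoint_union) (use Q(1) in blast)
    show "linked ends X" if "X \<in> Cs \<union> Q" for X
      using that cycle_linked[of E ends X] assms(6) CE ends_ne Q(4) by blast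
    show "even (degree_in X ends v)" if "X \<in> Cs \<union> Q" for X v
      using that deg_C Q(4) by auto
    show "{} \<notin> Cs \<union> Q" using assms(6) Q(3) by (auto simp: is_cycle_def)
    show "\<Union>(Cs \<union> Q) = E" using Q(1) CE by auto
  qed (use fin ends assms(2,5,6) deg_C in \<open>auto simp: regular_def\<close>)
  show ?thesis
    using balanced_factor unfolding is_factor_def regular_def by blast
qed

end
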